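(* Let $\Bbbk$ be a field of characteristic zero and let $\mathbf f,\mathbf g\in\Bbbk[x,y]$ be two nonzero polynomials. Suppose that (a) $\phi$ is a Poisson morphism from $K\{\mathbf f\}$ to $K\{\mathbf g\}$, and (b) $\mathbf f=c\prod_{i=1}^m(x+\xi_i)\prod_{j=1}^n(y+\chi_j)$ where $c\in\Bbbk^\times$ and $(\xi_i)_{i=1}^m$, $(\chi_j)_{j=1}^n$ are families of distinct scalars in $\Bbbk$, with $m,n\ge3$. Then the following hold. (1) $\phi(\mathbf f)\in\Bbbk[x,y]\,\mathbf g$ and $\deg\mathbf f\le\deg\mathbf g$. (2) If $\deg\mathbf f=\deg\mathbf g$, then $\phi$ preserves the degree. Consequently, $\phi$ is a $\Bbbk$-algebra isomorphism sending $x\mapsto c_{11}x+c_{12}y+c_1$ and $y\mapsto c_{21}x+c_{22}y+c_2$ for some $c_1,c_2\in\Bbbk$ and some $\begin{pmatrix}c_{11}&c_{12}\\c_{21}&c_{22}\end{pmatrix}\in GL_2(\Bbbk)$. Further, $\phi(\mathbf f)=(c_{11}c_{22}-c_{12}c_{21})\,\mathbf g$. (3) $K\{\mathbf f\}$ has the Dixmier property. (4) $\mathrm{Aut}_{Poi}(K\{\mathbf f\})$ is isomorphic to a subgroup of $\{\psi\in\mathrm{Aut}(\Bbbk[x,y])\mid\psi(\mathbf f)\in\Bbbk^\times\mathbf f\}$.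
   Context: For $\mathbf f\in\Bbbk(x,y)$, $K\{\mathbf f\}$ denotes the rational function field $\Bbbk(x,y)$ equipped with the unique ($\Bbbk$-bilinear) Poisson bracket such that $\{x,y\}=\mathbf f$; explicitly $\{g,h\}=\left(\frac{\partial g}{\partial x}\frac{\partial h}{\partial y}-\frac{\partial g}{\partial y}\frac{\partial h}{\partial x}\right)\mathbf f$. A Poisson morphism is a $\Bbbk$-algebra homomorphism preserving Poisson brackets; $\mathrm{Aut}_{Poi}(K)$ is the group of bijective Poisson endomorphisms of $K$; $\mathrm{Aut}(\Bbbk[x,y])$ is the group of $\Bbbk$-algebra automorphisms. $\deg$ is total degree in $x,y$. A Poisson field $K$ has the Dixmier property if every Poisson endomorphism of $K$ is an automorphism. *)

theory Defs
  imports
    "HOL-Computational_Algebra.Fraction_Field"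
    "HOL-Computational_Algebra.Polynomial"
    "HOL-Algebra.Bij"
    "HOL-Analysis.Determinants"
begin

section \<open>Polynomials and rational functions in two variables\<close>

text \<open>
  The ring \<open>k[x,y]\<close> is the type \<open>'k poly poly\<close>: the inner variable is \<open>x\<close>, the outer one is \<open>y\<close>,
  so the coefficient of \<open>x^i y^j\<close> in \<open>p\<close> is \<open>coeff (coeff p j) i\<close>.
\<close>

type_synonym 'k poly2 = "'k poly poly"
type_synonym 'k rat2 = "'k poly poly fract"

definition pconst :: "'k \<Rightarrow> 'k::field_char_0 poly2"
  where "pconst c = [:[:c:]:]"

definition pX :: "'k::field_char_0 poly2"
  where "pX = [:[:0, 1:]:]"

definition pY :: "'k::field_char_0 poly2"
  where "pY = [:0, 1:]"

definition emb :: "'k::field_char_0 poly2 \<Rightarrow> 'k rat2"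
  where "emb p = Fraction_Field.Fract p 1"

definition rconst :: "'k \<Rightarrow> 'k::field_char_0 rat2"
  where "rconst c = emb (pconst c)"

definition rX :: "'k::field_char_0 rat2"
  where "rX = emb pX"

definition rY :: "'k::field_char_0 rat2"
  where "rY = emb pY"


section \<open>Total degree\<close>

text \<open>The value at \<open>0\<close> is a convention; only degrees of nonzero elements are meaningful.\<close>

definition pdeg :: "'k::field_char_0 poly2 \<Rightarrow> nat"
  where "pdeg p = (if p = 0 then 0 else Max {i + j | i j. coeff (coeff p j) i \<noteq> 0})"

lemma finite_pdeg: "finite {i + j | i j. coeff (coeff p j) i \<noteq> (0::'k::field_char_0)}"
proof -
  have "{i + j | i j. coeff (coeff p j) i \<noteq> 0}
      \<subseteq> (\<lambda>(i, j). i + j) ` (SIGMA i:(\<Union>j\<le>degree p. {..degree (coeff p j)}). {..degree p})"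
  proof clarify
    fix i j assume h: "coeff (coeff p j) i \<noteq> 0"
    then have "coeff p j \<noteq> 0" by auto
    then have "j \<le> degree p" by (rule le_degree)
    moreover have "i \<le> degree (coeff p j)" using h by (rule le_degree)
    ultimately show "i + j \<in> (\<lambda>(i, j). i + j) `
        (SIGMA i:(\<Union>j\<le>degree p. {..degree (coeff p j)}). {..degree p})"
      by (intro image_eqI[of _ _ "(i, j)"]) auto
  qed
  then show ?thesis by (rule finite_subset) auto
qed

lemma pdeg_ge: "i + j \<le> pdeg p" if "coeff (coeff p j) i \<noteq> 0"
proof -
  have "p \<noteq> 0" using that by auto
  then show ?thesis
    unfolding pdeg_def using that by (auto intro!: Max_ge finite_pdeg)
qed

lemma pdeg_attained:
  assumes "p \<noteq> 0"
  shows "\<exists>i j. coeff (coeff p j) i \<noteq> 0 \<and> i + j = pdeg p \<and>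
    (\<forall>i' j'. coeff (coeff p j') i' \<noteq> 0 \<longrightarrow> i' + j' = pdeg p \<longrightarrow> j' \<le> j)"
proof -
  have "{i + j | i j. coeff (coeff p j) i \<noteq> 0} \<noteq> {}"
    using assms by (auto simp: poly_eq_iff)
  from Max_in[OF finite_pdeg this]
  have "pdeg p \<in> {i + j | i j. coeff (coeff p j) i \<noteq> 0}"
    unfolding pdeg_def using assms by simp
  then obtain i0 j0 where 0: "coeff (coeff p j0) i0 \<noteq> 0" "i0 + j0 = pdeg p" by auto
  define P where "P j \<longleftrightarrow> (\<exists>i. coeff (coeff p j) i \<noteq> 0 \<and> i + j = pdeg p)" for j
  have P0: "P j0" using 0 P_def by blast
  have bd: "\<And>j. P j \<Longrightarrow> j \<le> pdeg p" unfolding P_def by auto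
  define j where "j = Greatest P"
  have "P j" unfolding j_def using GreatestI_nat[of P, OF P0 bd] .
  moreover have "j' \<le> j" if "P j'" for j'
    unfolding j_def using Greatest_le_nat[of P, OF that bd] .
  ultimately show ?thesis unfolding P_def by blast
qed

lemma pdeg_mult:
  assumes "p \<noteq> 0" "q \<noteq> 0"
  shows "pdeg (p * q) = pdeg p + pdeg q"
proof -
  have cf: "coeff (coeff (p * q) J) I =
      (\<Sum>a\<le>J. \<Sum>b\<le>I. coeff (coeff p a) b * coeff (coeff q (J - a)) (I - b))" for I J
    by (simp add: coeff_mult coeff_sum)
  obtain i1 j1 where 1: "coeff (coeff p j1) i1 \<noteq> 0" "i1 + j1 = pdeg p"
    "\<forall>i' j'. coeff (coeff p j') i' \<noteq> 0 \<longrightarrow> i' + j' = pdeg p \<longrightarrow> j' \<le> j1"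
    using pdeg_attained[OF assms(1)] by auto
  obtain i2 j2 where 2: "coeff (coeff q j2) i2 \<noteq> 0" "i2 + j2 = pdeg q"
    "\<forall>i' j'. coeff (coeff q j') i' \<noteq> 0 \<longrightarrow> i' + j' = pdeg q \<longrightarrow> j' \<le> j2"
    using pdeg_attained[OF assms(2)] by auto
  have van: "coeff (coeff p a) b * coeff (coeff q (j1 + j2 - a)) (i1 + i2 - b) = 0"
    if "a \<le> j1 + j2" "b \<le> i1 + i2" "(a, b) \<noteq> (j1, i1)" for a b
  proof (rule ccontr)
    assume "\<not> ?thesis"
    then have n1: "coeff (coeff p a) b \<noteq> 0"
      and n2: "coeff (coeff q (j1 + j2 - a)) (i1 + i2 - b) \<noteq> 0" by auto
    have "b + a \<le> pdeg p" "(i1 + i2 - b) + (j1 + j2 - a) \<le> pdeg q"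
      using pdeg_ge[OF n1] pdeg_ge[OF n2] by auto
    then have e: "b + a = pdeg p" "(i1 + i2 - b) + (j1 + j2 - a) = pdeg q"
      using that 1(2) 2(2) by linarith+
    have "a \<le> j1" "j1 + j2 - a \<le> j2" using 1(3) 2(3) n1 n2 e by blast+
    then have "a = j1" by linarith
    moreover have "b = i1" using e(1) 1(2) \<open>a = j1\<close> by linarith
    ultimately show False using that by simp
  qed
  have "coeff (coeff (p * q) (j1 + j2)) (i1 + i2) =
      (\<Sum>a\<le>j1 + j2. \<Sum>b\<le>i1 + i2.
        if a = j1 \<and> b = i1 then coeff (coeff p j1) i1 * coeff (coeff q j2) i2 else 0)"
    unfolding cf by (intro sum.cong refl) (use van in auto)
  also have "\<dots> = (\<Sum>(a, b)\<in>{..j1 + j2} \<times> {..i1 + i2}.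
        if (a, b) = (j1, i1) then coeff (coeff p j1) i1 * coeff (coeff q j2) i2 else 0)"
    by (simp add: sum.cartesian_product)
  also have "\<dots> = coeff (coeff p j1) i1 * coeff (coeff q j2) i2"
    by (subst sum.remove[of _ "(j1, i1)"]) (auto intro!: sum.neutral split: if_splits)
  finally have "coeff (coeff (p * q) (j1 + j2)) (i1 + i2) \<noteq> 0" using 1(1) 2(1) by simp
  then have "pdeg p + pdeg q \<le> pdeg (p * q)"
    using pdeg_ge[of "p * q" "j1 + j2" "i1 + i2"] 1(2) 2(2) by simp
  moreover have "pdeg (p * q) \<le> pdeg p + pdeg q"
  proof -
    have "p * q \<noteq> 0" using assms by simp
    then obtain I J where IJ: "coeff (coeff (p * q) J) I \<noteq> 0" "I + J = pdeg (p * q)"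
      using pdeg_attained by metis
    then obtain a b where ab: "a \<le> J" "b \<le> I"
      "coeff (coeff p a) b * coeff (coeff q (J - a)) (I - b) \<noteq> 0"
      unfolding cf by (meson sum.not_neutral_contains_not_neutral atMost_iff)
    then have "coeff (coeff p a) b \<noteq> 0" "coeff (coeff q (J - a)) (I - b) \<noteq> 0" by auto
    then have "b + a \<le> pdeg p" "(I - b) + (J - a) \<le> pdeg q"
      using pdeg_ge by blast+
    then show ?thesis using IJ(2) ab(1,2) by linarith
  qed
  ultimately show ?thesis by simp
qed

text \<open>The degree of a fraction \<open>a/b\<close> is \<open>deg a - deg b\<close>.\<close>

lift_definition rdeg :: "'k::field_char_0 rat2 \<Rightarrow> int"
  is "\<lambda>(a, b). if a = 0 then 0 else int (pdeg a) - int (pdeg b)"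
proof -
  fix u v :: "'k poly2 \<times> 'k poly2"
  obtain a b c d where uv: "u = (a, b)" "v = (c, d)" by (cases u, cases v) auto
  assume "fractrel u v"
  then have h: "b \<noteq> 0" "d \<noteq> 0" "a * d = c * b" using uv by auto
  have "a = 0 \<longleftrightarrow> c = 0" using h by auto
  moreover have "int (pdeg a) - int (pdeg b) = int (pdeg c) - int (pdeg d)"
    if "a \<noteq> 0" "c \<noteq> 0"
    using pdeg_mult[of a d] pdeg_mult[of c b] h that by simp
  ultimately show "(case u of (a, b) \<Rightarrow> if a = 0 then 0 else int (pdeg a) - int (pdeg b)) =
      (case v of (a, b) \<Rightarrow> if a = 0 then 0 else int (pdeg a) - int (pdeg b))"
    unfolding uv by simp
qed

lemma rdeg_Fract: "a \<noteq> 0 \<Longrightarrow> b \<noteq> 0 \<Longrightarrow> rdeg (Fraction_Field.Fract a b) = int (pdeg a) - int (pdeg b)"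
  by transfer simp


section \<open>Partial derivatives and the Poisson bracket\<close>

definition pdx :: "'k::field_char_0 poly2 \<Rightarrow> 'k poly2"
  where "pdx = map_poly pderiv"

definition pdy :: "'k::field_char_0 poly2 \<Rightarrow> 'k poly2"
  where "pdy = pderiv"

lemma pdx_mult: "pdx (p * q) = pdx p * q + p * pdx q"
proof -
  have pds: "pderiv (sum g A) = (\<Sum>a\<in>A. pderiv (g a))" for g :: "nat \<Rightarrow> 'a poly" and A
    by (induction A rule: infinite_finite_induct) (auto simp: pderiv_add)
  have pm: "pderiv (a * b) = pderiv a * b + a * pderiv b" for a b :: "'a poly"
    by (simp add: pderiv_mult algebra_simps)
  show ?thesis
    unfolding pdx_def
    by (rule poly_eqI) (simp add: coeff_map_poly coeff_mult pds pm sum.distrib)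
qed

lemma pdy_mult: "pdy (p * q) = pdy p * q + p * pdy q"
  by (simp add: pdy_def pderiv_mult algebra_simps)

lemma quotient_rule_fractrel:
  fixes D :: "'r::idom \<Rightarrow> 'r"
  assumes D: "\<And>p q. D (p * q) = D p * q + p * D q" and uv: "fractrel u v"
  shows "fractrel (case u of (a, b) \<Rightarrow> (D a * b - a * D b, b * b))
                  (case v of (a, b) \<Rightarrow> (D a * b - a * D b, b * b))"
proof -
  obtain a b c d where e: "u = (a, b)" "v = (c, d)" by (cases u, cases v) auto
  have h: "b \<noteq> 0" "d \<noteq> 0" "a * d = c * b" using uv e by auto
  have "D a * d + a * D d = D c * b + c * D b" using D h(3) by metis
  then have "(D a * b - a * D b) * (d * d) = (D c * d - c * D d) * (b * b)"
    using h(3) by algebra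
  then show ?thesis using e h by simp
qed

lift_definition rdx :: "'k::field_char_0 rat2 \<Rightarrow> 'k rat2"
  is "\<lambda>(a, b). (pdx a * b - a * pdx b, b * b)"
  by (rule quotient_rule_fractrel[OF pdx_mult])

lift_definition rdy :: "'k::field_char_0 rat2 \<Rightarrow> 'k rat2"
  is "\<lambda>(a, b). (pdy a * b - a * pdy b, b * b)"
  by (rule quotient_rule_fractrel[OF pdy_mult])

lemma rdx_Fract: "b \<noteq> 0 \<Longrightarrow> rdx (Fraction_Field.Fract a b) = Fraction_Field.Fract (pdx a * b - a * pdx b) (b * b)"
  by transfer simp

lemma rdy_Fract: "b \<noteq> 0 \<Longrightarrow> rdy (Fraction_Field.Fract a b) = Fraction_Field.Fract (pdy a * b - a * pdy b) (b * b)"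
  by transfer simp

text \<open>The bracket of \<open>K{f}\<close>.\<close>

definition pbracket :: "'k::field_char_0 rat2 \<Rightarrow> 'k rat2 \<Rightarrow> 'k rat2 \<Rightarrow> 'k rat2"
  where "pbracket f g h = (rdx g * rdy h - rdy g * rdx h) * f"

lemma pbracket_X_Y: "pbracket f rX rY = f"
proof -
  have "rdx rX = (1 :: 'a rat2)" "rdy rX = (0 :: 'a rat2)"
    "rdx rY = (0 :: 'a rat2)" "rdy rY = (1 :: 'a rat2)"
    by (simp_all add: rX_def rY_def emb_def pX_def pY_def rdx_Fract rdy_Fract pdx_def pdy_def
        pderiv_pCons map_poly_pCons one_pCons One_fract_def Zero_fract_def)
  then show ?thesis by (simp add: pbracket_def)
qed


section \<open>Morphisms and automorphism groups\<close>

text \<open>A \<open>k\<close>-algebra is given here by its structure map \<open>k \<Rightarrow> A\<close>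
  (\<open>pconst\<close> for \<open>k[x,y]\<close>, \<open>rconst\<close> for \<open>k(x,y)\<close>).\<close>

definition alg_hom :: "('k \<Rightarrow> 'a::comm_ring_1) \<Rightarrow> ('k \<Rightarrow> 'b::comm_ring_1) \<Rightarrow> ('a \<Rightarrow> 'b) \<Rightarrow> bool"
  where "alg_hom e e' \<phi> \<longleftrightarrow>
    (\<forall>a b. \<phi> (a + b) = \<phi> a + \<phi> b) \<and> (\<forall>a b. \<phi> (a * b) = \<phi> a * \<phi> b) \<and>
    (\<forall>c. \<phi> (e c) = e' c) \<and> \<phi> 1 = 1"

definition alg_iso :: "('k \<Rightarrow> 'a::comm_ring_1) \<Rightarrow> ('k \<Rightarrow> 'b::comm_ring_1) \<Rightarrow> ('a \<Rightarrow> 'b) \<Rightarrow> bool"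
  where "alg_iso e e' \<phi> \<longleftrightarrow> alg_hom e e' \<phi> \<and> bij \<phi>"

definition poisson_morphism ::
    "'k::field_char_0 rat2 \<Rightarrow> 'k rat2 \<Rightarrow> ('k rat2 \<Rightarrow> 'k rat2) \<Rightarrow> bool"
  where "poisson_morphism f g \<phi> \<longleftrightarrow> alg_hom rconst rconst \<phi> \<and>
    (\<forall>a b. \<phi> (pbracket f a b) = pbracket g (\<phi> a) (\<phi> b))"

definition poisson_aut :: "'k::field_char_0 rat2 \<Rightarrow> ('k rat2 \<Rightarrow> 'k rat2) \<Rightarrow> bool"
  where "poisson_aut f \<phi> \<longleftrightarrow> poisson_morphism f f \<phi> \<and> bij \<phi>"

definition dixmier :: "'k::field_char_0 rat2 \<Rightarrow> bool"
  where "dixmier f \<longleftrightarrow> (\<forall>\<phi>. poisson_morphism f f \<phi> \<longrightarrow> poisson_aut f \<phi>)"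

definition Aut_Poi :: "'k::field_char_0 rat2 \<Rightarrow> ('k rat2 \<Rightarrow> 'k rat2) monoid"
  where "Aut_Poi f = BijGroup UNIV \<lparr>carrier := {\<phi>. poisson_aut f \<phi>}\<rparr>"

definition Aut_semi_invariant :: "'k::field_char_0 poly2 \<Rightarrow> ('k poly2 \<Rightarrow> 'k poly2) monoid"
  where "Aut_semi_invariant f = BijGroup UNIV
    \<lparr>carrier := {\<psi>. alg_iso pconst pconst \<psi> \<and> (\<exists>c. c \<noteq> 0 \<and> \<psi> f = pconst c * f)}\<rparr>"

lemma alg_hom_comp: "alg_hom e' e'' \<psi> \<Longrightarrow> alg_hom e e' \<phi> \<Longrightarrow> alg_hom e e'' (\<psi> \<circ> \<phi>)"
  by (simp add: alg_hom_def)

lemma alg_hom_inv: "alg_hom e e' \<phi> \<Longrightarrow> bij \<phi> \<Longrightarrow> alg_hom e' e (inv_into UNIV \<phi>)"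
  unfolding alg_hom_def by (intro conjI allI) (metis bij_inv_eq_iff)+

lemma subgroup_BijGroup_UNIV:
  assumes "\<And>\<phi>. P \<phi> \<Longrightarrow> bij \<phi>" "P id" "\<And>\<phi> \<psi>. P \<phi> \<Longrightarrow> P \<psi> \<Longrightarrow> P (\<psi> \<circ> \<phi>)"
    "\<And>\<phi>. P \<phi> \<Longrightarrow> P (inv_into UNIV \<phi>)"
  shows "subgroup {\<phi>. P \<phi>} (BijGroup UNIV)"
proof (rule subgroup.intro)
  have B: "Bij UNIV = Collect bij" by (auto simp: Bij_def)
  show "{\<phi>. P \<phi>} \<subseteq> carrier (BijGroup UNIV)"
    using assms(1) by (auto simp: BijGroup_def B)
  show "\<one>\<^bsub>BijGroup UNIV\<^esub> \<in> {\<phi>. P \<phi>}"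
    using assms(2) by (simp add: BijGroup_def id_def restrict_def)
  show "x \<otimes>\<^bsub>BijGroup UNIV\<^esub> y \<in> {\<phi>. P \<phi>}" if "x \<in> {\<phi>. P \<phi>}" "y \<in> {\<phi>. P \<phi>}" for x y
    using that assms(1,3) by (simp add: BijGroup_def B compose_def comp_def restrict_def)
  show "inv\<^bsub>BijGroup UNIV\<^esub> x \<in> {\<phi>. P \<phi>}" if "x \<in> {\<phi>. P \<phi>}" for x
    using that assms(1,4) by (subst inv_BijGroup) (auto simp: B restrict_def)
qed

lemma subgroup_Aut_Poi: "subgroup (carrier (Aut_Poi f)) (BijGroup UNIV)"
proof -
  have "poisson_aut f id"
    by (simp add: poisson_aut_def poisson_morphism_def alg_hom_def)
  moreover have "poisson_aut f (\<psi> \<circ> \<phi>)" if "poisson_aut f \<phi>" "poisson_aut f \<psi>" for \<phi> \<psi>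
    using that by (auto simp: poisson_aut_def poisson_morphism_def bij_comp intro: alg_hom_comp)
  moreover have "poisson_aut f (inv_into UNIV \<phi>)" if "poisson_aut f \<phi>" for \<phi>
  proof -
    have b: "bij \<phi>" and h: "alg_hom rconst rconst \<phi>"
      and p: "\<And>a b. \<phi> (pbracket f a b) = pbracket f (\<phi> a) (\<phi> b)"
      using that by (simp_all add: poisson_aut_def poisson_morphism_def)
    have s: "\<phi> (inv_into UNIV \<phi> a) = a" for a
      using b by (simp add: bij_is_surj surj_f_inv_f)
    have "\<phi> (pbracket f (inv_into UNIV \<phi> u) (inv_into UNIV \<phi> v)) = pbracket f u v" for u v
      by (simp add: p s)
    then have "inv_into UNIV \<phi> (pbracket f u v)
        = pbracket f (inv_into UNIV \<phi> u) (inv_into UNIV \<phi> v)" for u v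
      using b by (metis bij_inv_eq_iff)
    then show ?thesis
      using alg_hom_inv[OF h b] bij_imp_bij_inv[OF b]
      by (simp add: poisson_aut_def poisson_morphism_def)
  qed
  ultimately show ?thesis
    unfolding Aut_Poi_def by (simp, intro subgroup_BijGroup_UNIV) (simp_all add: poisson_aut_def)
qed

lemma subgroup_Aut_semi_invariant:
  "subgroup (carrier (Aut_semi_invariant f)) (BijGroup UNIV)"
proof -
  let ?P = "\<lambda>\<psi>. alg_iso pconst pconst \<psi> \<and> (\<exists>c. c \<noteq> 0 \<and> \<psi> f = pconst c * f)"
  have pc: "pconst a * pconst b = pconst (a * b)" for a b :: 'a
    by (simp add: pconst_def)
  have 1: "?P id"
  proof -
    have "id f = pconst 1 * f" by (simp add: pconst_def flip: one_pCons)
    moreover have "(1::'a) \<noteq> 0" by simp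
    moreover have "alg_iso pconst pconst (id :: 'a poly2 \<Rightarrow> 'a poly2)"
      by (simp add: alg_iso_def alg_hom_def)
    ultimately show ?thesis by blast
  qed
  have 2: "?P (\<psi> \<circ> \<phi>)" if P: "?P \<phi>" "?P \<psi>" for \<phi> \<psi>
  proof -
    obtain a b where "a \<noteq> 0" "\<phi> f = pconst a * f" "b \<noteq> 0" "\<psi> f = pconst b * f"
      using P by blast
    then have "a * b \<noteq> 0 \<and> (\<psi> \<circ> \<phi>) f = pconst (a * b) * f"
      using P by (simp add: alg_iso_def alg_hom_def pc[symmetric] mult.assoc)
    moreover have "alg_iso pconst pconst (\<psi> \<circ> \<phi>)"
      using P by (auto simp: alg_iso_def bij_comp intro: alg_hom_comp)
    ultimately show ?thesis by blast
  qed
  have 3: "?P (inv_into UNIV \<phi>)" if P: "?P \<phi>" for \<phi>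
  proof -
    obtain a where a: "a \<noteq> 0" "\<phi> f = pconst a * f" using P by blast
    have b: "bij \<phi>" and h: "alg_hom pconst pconst \<phi>" using P by (auto simp: alg_iso_def)
    have "pconst (inverse a) * (pconst a * f) = f"
      using a(1) by (simp add: mult.assoc[symmetric] pc) (simp add: pconst_def flip: one_pCons)
    then have "\<phi> (pconst (inverse a) * f) = f"
      using h a(2) by (simp add: alg_hom_def)
    then have "inv_into UNIV \<phi> f = pconst (inverse a) * f"
      using b by (metis bij_inv_eq_iff)
    moreover have "inverse a \<noteq> 0" using a(1) by simp
    ultimately show ?thesis
      using alg_hom_inv[OF h b] bij_imp_bij_inv[OF b] unfolding alg_iso_def by blast
  qed
  have "subgroup {\<psi>. ?P \<psi>} (BijGroup UNIV)"
    by (rule subgroup_BijGroup_UNIV[of ?P, OF _ 1 2 3]) (simp_all add: alg_iso_def)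
  then show ?thesis unfolding Aut_semi_invariant_def by simp
qed

lemma group_Aut_Poi: "group (Aut_Poi f)"
  using subgroup.subgroup_is_group[OF subgroup_Aut_Poi group_BijGroup, of f]
  by (simp add: Aut_Poi_def)

lemma group_Aut_semi_invariant: "group (Aut_semi_invariant f)"
  using subgroup.subgroup_is_group[OF subgroup_Aut_semi_invariant group_BijGroup, of f]
  by (simp add: Aut_semi_invariant_def)

end

theory Submission
  imports Defs "Berlekamp_Zassenhaus.Unique_Factorization_Poly"
begin

text \<open>
  Write \<open>u = \<phi> x\<close> and \<open>v = \<phi> y\<close>; preservation of the bracket says that the Jacobian of \<open>(u, v)\<close>
  times \<open>g\<close> is \<open>\<phi> f = c \<Prod>(u + \<xi>\<^sub>i) \<Prod>(v + \<eta>\<^sub>j)\<close>. At a prime \<open>p\<close> of \<open>k[x,y]\<close> the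
  Jacobian has valuation at least \<open>\<nu>(u) + \<nu>(v) - 1\<close>. Since the scalars are distinct, at most one factor
  in each product vanishes along \<open>p\<close>, whereas a pole of \<open>u\<close> or \<open>v\<close> is a pole of at least three factors,
  which would force \<open>g\<close> to have a pole too. Hence \<open>u\<close> and \<open>v\<close> are polynomials. As the Jacobian
  lowers the degree by two, comparing degrees gives \<open>deg f \<le> deg g\<close>, with equality only when \<open>u\<close> and
  \<open>v\<close> are affine linear; the Jacobian is then the determinant. For \<open>f = g\<close> equality always holds, and an
  automorphism is determined by its restriction to \<open>k[x,y]\<close>.
\<close>

section \<open>The valuation at a prime element\<close>

text \<open>The \<open>p\<close>-adic valuation of \<open>u\<close>, bounded below by
  \<open>n\<close>. A relation needs no infinite value at 0, which satisfies it for every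
  \<open>n\<close> when \<open>p\<close> is prime; the numerator may still contain factors
  \<open>p\<close>.\<close>

definition valge :: "'a::idom \<Rightarrow> int \<Rightarrow> 'a fract \<Rightarrow> bool"
  where "valge p n u \<longleftrightarrow>
    (\<exists>s t. \<not> p dvd t \<and> u = to_fract p powi n * (to_fract s / to_fract t))"

text \<open>The exact valuation: for prime \<open>p\<close> the quotient of \<open>s\<close> and
  \<open>t\<close> is a unit of the local ring at \<open>p\<close>, so \<open>u = 0\<close> is
  excluded.\<close>

definition valeq :: "'a::idom \<Rightarrow> int \<Rightarrow> 'a fract \<Rightarrow> bool"
  where "valeq p n u \<longleftrightarrow>
    (\<exists>s t. \<not> p dvd s \<and> \<not> p dvd t \<and> u = to_fract p powi n * (to_fract s / to_fract t))"

lemma valeq_imp_valge: "valeq p n u \<Longrightarrow> valge p n u"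
  unfolding valeq_def valge_def by blast

context
  fixes p :: "'a::idom"
  assumes p: "prime_elem p"
begin

private lemma p0: "to_fract p \<noteq> 0"
  using p by (simp add: prime_elem_def)

private lemma ndvd_mult: "\<not> p dvd s \<Longrightarrow> \<not> p dvd t \<Longrightarrow> \<not> p dvd s * t"
  using p by (simp add: prime_elem_dvd_mult_iff)

lemma valge_0: "valge p n 0"
  unfolding valge_def using p by (intro exI[of _ 0] exI[of _ 1]) (simp add: prime_elem_def)

lemma valge_to_fract: "valge p 0 (to_fract s)"
  unfolding valge_def using p by (intro exI[of _ s] exI[of _ 1]) (simp add: prime_elem_def)

lemma valeq_to_fract: "\<not> p dvd s \<Longrightarrow> valeq p 0 (to_fract s)"
  unfolding valeq_def using p by (intro exI[of _ s] exI[of _ 1]) (simp add: prime_elem_def)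

lemma valeq_1: "valeq p 0 1"
  using valeq_to_fract[of 1] p by (simp add: prime_elem_def)

lemma valge_powi: "valge p n (to_fract p powi n)"
  unfolding valge_def using p by (intro exI[of _ 1]) (simp add: prime_elem_def)

lemma valge_mult:
  assumes "valge p m u" "valge p n v"
  shows "valge p (m + n) (u * v)"
proof -
  obtain s t where 1: "\<not> p dvd t" "u = to_fract p powi m * (to_fract s / to_fract t)"
    using assms(1) unfolding valge_def by blast
  obtain s' t' where 2: "\<not> p dvd t'" "v = to_fract p powi n * (to_fract s' / to_fract t')"
    using assms(2) unfolding valge_def by blast
  have "u * v = to_fract p powi (m + n) * (to_fract (s * s') / to_fract (t * t'))"
    using 1 2 p0 by (simp add: power_int_add)
  then show ?thesis unfolding valge_def using ndvd_mult[OF 1(1) 2(1)] by blast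
qed

lemma valeq_mult:
  assumes "valeq p m u" "valeq p n v"
  shows "valeq p (m + n) (u * v)"
proof -
  obtain s t where 1: "\<not> p dvd s" "\<not> p dvd t" "u = to_fract p powi m * (to_fract s / to_fract t)"
    using assms(1) unfolding valeq_def by blast
  obtain s' t' where 2: "\<not> p dvd s'" "\<not> p dvd t'" "v = to_fract p powi n * (to_fract s' / to_fract t')"
    using assms(2) unfolding valeq_def by blast
  have "u * v = to_fract p powi (m + n) * (to_fract (s * s') / to_fract (t * t'))"
    using 1 2 p0 by (simp add: power_int_add)
  then show ?thesis
    unfolding valeq_def using ndvd_mult[OF 1(1) 2(1)] ndvd_mult[OF 1(2) 2(2)] by blast
qed

text \<open>The surplus power of \<open>p\<close> is absorbed by the numerator.\<close>

lemma valge_mono: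
  assumes "valge p n u" "m \<le> n"
  shows "valge p m u"
proof -
  obtain s t where 1: "\<not> p dvd t" "u = to_fract p powi n * (to_fract s / to_fract t)"
    using assms(1) unfolding valge_def by blast
  have "to_fract p powi n = to_fract p powi m * to_fract (p ^ nat (n - m))"
    using assms(2) p0 power_int_add[of "to_fract p" m "n - m"]
    by (simp add: power_int_def to_fract_hom.hom_power)
  then have "u = to_fract p powi m * (to_fract (p ^ nat (n - m) * s) / to_fract t)"
    using 1 by simp
  then show ?thesis unfolding valge_def using 1 by blast
qed

lemma valge_add:
  assumes "valge p n u" "valge p n v"
  shows "valge p n (u + v)"
proof -
  obtain s t where 1: "\<not> p dvd t" "u = to_fract p powi n * (to_fract s / to_fract t)"
    using assms(1) unfolding valge_def by blast
  obtain s' t' where 2: "\<not> p dvd t'" "v = to_fract p powi n * (to_fract s' / to_fract t')"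
    using assms(2) unfolding valge_def by blast
  have "t \<noteq> 0" "t' \<noteq> 0" using 1 2 by auto
  then have "u + v = to_fract p powi n * (to_fract (s * t' + s' * t) / to_fract (t * t'))"
    using 1 2 by (simp add: field_simps)
  then show ?thesis unfolding valge_def using ndvd_mult[OF 1(1) 2(1)] by blast
qed

lemma valge_uminus: "valge p n u \<Longrightarrow> valge p n (- u)"
  using valge_mult[OF valge_to_fract[of "-1"], of n u] by simp

lemma valge_diff: "valge p n u \<Longrightarrow> valge p n v \<Longrightarrow> valge p n (u - v)"
  using valge_add[of n u "- v"] valge_uminus[of n v] by simp

text \<open>If \<open>p\<close> divided the numerator, one more factor \<open>p\<close> could be
  pulled out, raising the bound to \<open>n + 1\<close>.\<close>

lemma valge_imp_valeq:
  assumes "valge p n u" "\<not> valge p (n + 1) u"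
  shows "valeq p n u"
proof -
  obtain s t where 1: "\<not> p dvd t" "u = to_fract p powi n * (to_fract s / to_fract t)"
    using assms(1) unfolding valge_def by blast
  have "\<not> p dvd s"
  proof
    assume "p dvd s"
    then obtain r where "s = p * r" by blast
    then have "u = to_fract p powi (n + 1) * (to_fract r / to_fract t)"
      using 1 p0 by (simp add: power_int_add)
    then show False using assms(2) 1(1) unfolding valge_def by blast
  qed
  then show ?thesis unfolding valeq_def using 1 by blast
qed

text \<open>Cross-multiplying the two representations would make \<open>p\<close> divide
  \<open>s' * t\<close>, a product of two elements that \<open>p\<close> does not divide.\<close>

lemma valeq_imp_not_valge:
  assumes "valeq p n u" "n < m"
  shows "\<not> valge p m u"
proof
  assume "valge p m u"
  then have "valge p (n + 1) u" using assms(2) valge_mono by simp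
  then obtain s t where 1: "\<not> p dvd t" "u = to_fract p powi (n + 1) * (to_fract s / to_fract t)"
    unfolding valge_def by blast
  obtain s' t' where 2: "\<not> p dvd s'" "\<not> p dvd t'" "u = to_fract p powi n * (to_fract s' / to_fract t')"
    using assms(1) unfolding valeq_def by blast
  have "t \<noteq> 0" "t' \<noteq> 0" using 1 2 by auto
  moreover have "to_fract p * (to_fract s / to_fract t) = to_fract s' / to_fract t'"
  proof -
    have nz: "to_fract p powi n \<noteq> 0" using p0 by simp
    have "to_fract p powi n * (to_fract p * (to_fract s / to_fract t))
        = to_fract p powi n * (to_fract s' / to_fract t')"
      using 1(2) 2(3) p0 by (simp add: power_int_add mult.assoc)
    then show ?thesis using mult_left_cancel[OF nz] by blast
  qed
  ultimately have "to_fract (p * (s * t')) = to_fract (s' * t)"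
    by (simp add: field_simps)
  then have "p * (s * t') = s' * t" by (simp only: to_fract_eq_iff)
  then have "p dvd s' * t" by (metis dvd_triv_left)
  then show False using ndvd_mult[OF 2(1) 1(1)] by blast
qed

text \<open>The sharp ultrametric rule: if the sum had higher order, subtracting \<open>v\<close>
  would give \<open>u\<close> higher order as well.\<close>

lemma valeq_add:
  assumes "valeq p n u" "valge p (n + 1) v"
  shows "valeq p n (u + v)"
proof (rule valge_imp_valeq)
  show "valge p n (u + v)"
    using assms by (intro valge_add) (auto intro: valeq_imp_valge valge_mono)
  show "\<not> valge p (n + 1) (u + v)"
    using valge_diff[of "n + 1" "u + v" v] assms(2) valeq_imp_not_valge[OF assms(1), of "n + 1"]
    by auto
qed

lemma valeq_prod:
  assumes "\<And>i. i \<in> A \<Longrightarrow> valeq p n (v i)"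
  shows "valeq p (int (card A) * n) (prod v A)"
  using assms
proof (induction A rule: infinite_finite_induct)
  case (insert x F)
  then show ?case using valeq_mult[of n "v x" "int (card F) * n" "prod v F"]
    by (simp add: algebra_simps)
qed (simp_all add: valeq_1)

end

section \<open>Derivations and the Jacobian\<close>

text \<open>Stated for an abstract map with the Leibniz rule, so that it serves \<open>rdx\<close>
  and \<open>rdy\<close> alike. A negative exponent is handled by differentiating
  \<open>x ^ k * x powi n = 1\<close> with \<open>k = - n\<close> and solving for the derivative of
  the second factor.\<close>

lemma derivation_powi:
  fixes D :: "'a::field \<Rightarrow> 'a"
  assumes D: "\<And>u v. D (u * v) = D u * v + u * D v" and x: "x \<noteq> 0"
  shows "D (x powi n) = of_int n * x powi (n - 1) * D x"
proof -
  have D1: "D 1 = 0" by (metis D add_cancel_left_right mult_1 mult_1_right)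
  \<comment> \<open>At \<open>k = 0\<close> the exponent is -1, but the coefficient 0 removes the
    term.\<close>
  have nat: "D (x ^ k) = of_nat k * x powi (int k - 1) * D x" for k
  proof (induction k)
    case (Suc k)
    have "x * x powi (int k - 1) = x ^ k"
      using x by (simp add: power_int_diff)
    then show ?case using Suc by (simp add: D algebra_simps)
  qed (simp add: D1)
  show ?thesis
  proof (cases "n \<ge> 0")
    case True
    then show ?thesis using nat[of "nat n"] by (simp add: power_int_def)
  next
    case False
    define k where "k = nat (- n)"
    have n: "n = - int k" using False by (simp add: k_def)
    let ?y = "x powi n"
    have xk: "x ^ k * ?y = 1" using x by (simp add: n power_int_minus)
    have "0 = D (x ^ k * ?y)" by (simp add: xk D1)
    also have "\<dots> = of_nat k * x powi (int k - 1) * D x * ?y + x ^ k * D ?y"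
      by (simp add: D nat)
    finally have "x ^ k * D ?y = - (of_nat k * x powi (int k - 1) * D x * ?y)"
      by (simp add: eq_neg_iff_add_eq_0 add.commute)
    moreover have "D ?y = ?y * (x ^ k * D ?y)"
      using xk by (metis mult.assoc mult.commute mult_1)
    ultimately have "D ?y = - (of_nat k * (x powi (int k - 1) * ?y * ?y) * D x)"
      by (simp add: mult_ac)
    moreover have "x powi (int k - 1) * ?y * ?y = x powi (n - 1)"
      using x by (simp add: n power_int_diff power_int_minus field_simps)
    ultimately show ?thesis by (simp add: n)
  qed
qed

lemma valgeE:
  assumes "prime_elem p" "valge p n u"
  obtains s where "valge p 0 s" "u = to_fract p powi n * s"
proof -
  obtain s t where "\<not> p dvd t" "u = to_fract p powi n * (to_fract s / to_fract t)"
    using assms(2) unfolding valge_def by blast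
  then show ?thesis
    by (intro that[of "to_fract s / to_fract t"]) (auto simp: valge_def)
qed

section \<open>Partial derivatives and the Jacobian on rational functions\<close>

lemma emb_eq_to_fract: "emb p = to_fract p"
  by (simp add: emb_def to_fract_def)

lemma pdx_add: "pdx (p + q) = pdx p + pdx q"
  unfolding pdx_def by (rule poly_eqI) (simp add: coeff_map_poly pderiv_add)

lemma pdy_add: "pdy (p + q) = pdy p + pdy q"
  by (simp add: pdy_def pderiv_add)

lemma pd_const [simp]: "pdx (pconst c) = 0" "pdy (pconst c) = 0"
  by (auto simp: pdx_def pdy_def pconst_def pderiv_pCons coeff_map_poly coeff_pCons
      intro!: poly_eqI split: nat.split)

lemma pd_1 [simp]: "pdx 1 = 0" "pdy 1 = 0"
  using pd_const[of 1] by (simp_all add: pconst_def flip: one_pCons)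

lemma rdx_add: "rdx (u + v) = rdx u + rdx v"
proof (cases u, cases v)
  fix a b c d :: "'a poly2"
  assume u: "u = Fraction_Field.Fract a b" "b \<noteq> 0" and v: "v = Fraction_Field.Fract c d" "d \<noteq> 0"
  show ?thesis
    unfolding u(1) v(1) using u(2) v(2)
    by (simp add: rdx_Fract eq_fract pdx_add pdx_mult algebra_simps)
qed

lemma rdy_add: "rdy (u + v) = rdy u + rdy v"
proof (cases u, cases v)
  fix a b c d :: "'a poly2"
  assume u: "u = Fraction_Field.Fract a b" "b \<noteq> 0" and v: "v = Fraction_Field.Fract c d" "d \<noteq> 0"
  show ?thesis
    unfolding u(1) v(1) using u(2) v(2)
    by (simp add: rdy_Fract eq_fract pdy_add pdy_mult algebra_simps)
qed

lemma rdx_mult: "rdx (u * v) = rdx u * v + u * rdx v"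
proof (cases u, cases v)
  fix a b c d :: "'a poly2"
  assume u: "u = Fraction_Field.Fract a b" "b \<noteq> 0" and v: "v = Fraction_Field.Fract c d" "d \<noteq> 0"
  show ?thesis
    unfolding u(1) v(1) using u(2) v(2)
    by (simp add: rdx_Fract eq_fract pdx_mult algebra_simps)
qed

lemma rdy_mult: "rdy (u * v) = rdy u * v + u * rdy v"
proof (cases u, cases v)
  fix a b c d :: "'a poly2"
  assume u: "u = Fraction_Field.Fract a b" "b \<noteq> 0" and v: "v = Fraction_Field.Fract c d" "d \<noteq> 0"
  show ?thesis
    unfolding u(1) v(1) using u(2) v(2)
    by (simp add: rdy_Fract eq_fract pdy_mult algebra_simps)
qed

lemma rd_emb: "rdx (emb p) = emb (pdx p)" "rdy (emb p) = emb (pdy p)"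
  by (simp_all add: emb_def rdx_Fract rdy_Fract)

lemma rd_const [simp]: "rdx (rconst c) = 0" "rdy (rconst c) = 0"
  by (simp_all add: rconst_def rd_emb) (simp_all add: emb_eq_to_fract)

text \<open>The bracket with \<open>{x, y} = 1\<close>; \<open>pbracket f u v\<close> is
  \<open>jac u v * f\<close>.\<close>

definition jac :: "'k::field_char_0 rat2 \<Rightarrow> 'k rat2 \<Rightarrow> 'k rat2"
  where "jac u v = rdx u * rdy v - rdy u * rdx v"

text \<open>Permits shifting each argument to the root at which it vanishes along a given prime,
  before estimating the valuation.\<close>

lemma jac_add_const: "jac (u + rconst a) (v + rconst b) = jac u v"
  by (simp add: jac_def rdx_add rdy_add)

text \<open>The quotient rule merely squares the denominator, and a prime that does not divide
  \<open>t\<close> does not divide \<open>t * t\<close>. So the local ring at \<open>p\<close> is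
  stable under both derivatives.\<close>

lemma valge_rd:
  fixes u :: "'k::field_char_0 rat2"
  assumes p: "prime_elem p" and u: "valge p 0 u"
  shows "valge p 0 (rdx u)" "valge p 0 (rdy u)"
proof -
  obtain s t where st: "\<not> p dvd t" "u = to_fract s / to_fract t"
    using u unfolding valge_def by auto
  have t0: "t \<noteq> 0" using st by auto
  have u: "u = Fraction_Field.Fract s t" using st t0 by (simp add: to_fract_def)
  have tt: "\<not> p dvd t * t" using st p by (simp add: prime_elem_dvd_mult_iff)
  have *: "valge p 0 (Fraction_Field.Fract a (t * t))" for a
    unfolding valge_def using tt t0
    by (intro exI[of _ a] exI[of _ "t * t"] conjI tt) (simp add: to_fract_def)
  show "valge p 0 (rdx u)" "valge p 0 (rdy u)"
    unfolding u using t0 * by (simp_all add: rdx_Fract rdy_Fract)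
qed

text \<open>Each derivative could cost one factor \<open>p\<close>, yet the total loss is only one:
  the Leibniz term in which both powers of \<open>p\<close> are differentiated is a multiple of
  \<open>jac ?P ?P = 0\<close>.\<close>

lemma valge_jac:
  fixes u v :: "'k::field_char_0 rat2"
  assumes p: "prime_elem p" and u: "valge p a u" and v: "valge p b v"
  shows "valge p (a + b - 1) (jac u v)"
proof -
  let ?P = "to_fract p"
  have p0: "?P \<noteq> 0" using p by auto
  obtain s where s: "valge p 0 s" "u = ?P powi a * s" using valgeE[OF p u] by blast
  obtain t where t: "valge p 0 t" "v = ?P powi b * t" using valgeE[OF p v] by blast
  define A B where "A = ?P powi (a - 1)" and "B = ?P powi (b - 1)"
  have AB: "?P powi a = A * ?P" "?P powi b = B * ?P"
    using p0 by (simp_all add: A_def B_def power_int_diff)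
  have dA: "rdx (?P powi a) = of_int a * A * rdx ?P" "rdy (?P powi a) = of_int a * A * rdy ?P"
    "rdx (?P powi b) = of_int b * B * rdx ?P" "rdy (?P powi b) = of_int b * B * rdy ?P"
    using derivation_powi[of rdx, OF rdx_mult p0] derivation_powi[of rdy, OF rdy_mult p0]
    by (simp_all add: A_def B_def)
  \<comment> \<open>What remains of the Jacobian after \<open>?P powi (a + b - 1)\<close> is
    factored out.\<close>
  define R where "R = of_int a * s * jac ?P t + of_int b * t * jac s ?P + ?P * jac s t"
  \<comment> \<open>Written as images of polynomials, the integer coefficients have valuation at
    least 0 by \<open>valge_to_fract\<close>.\<close>
  have of_int: "(of_int n :: 'k rat2) = to_fract (of_int n)" for n
    by (simp add: to_fract_hom.hom_of_int)
  note vm = valge_mult[OF p, of 0 _ 0, simplified]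
  have "valge p 0 R"
    unfolding R_def jac_def of_int
    by (intro valge_add[OF p] valge_diff[OF p] vm valge_rd[OF p] valge_to_fract[OF p] s(1) t(1))
  moreover have "jac u v = A * (B * (?P * R))"
    unfolding s(2) t(2) R_def jac_def rdx_mult rdy_mult dA unfolding AB by (simp add: algebra_simps)
  moreover have "valge p 1 ?P"
    using valge_powi[OF p, of 1] by simp
  moreover have "valge p (a - 1) A" "valge p (b - 1) B"
    unfolding A_def B_def by (rule valge_powi[OF p])+
  ultimately have "valge p ((a - 1) + ((b - 1) + (1 + 0))) (jac u v)"
    using valge_mult[OF p] by metis
  then show ?thesis by (simp add: algebra_simps)
qed

section \<open>Total degree\<close>

lemma pdeg_leI:
  assumes "\<And>i j. coeff (coeff p j) i \<noteq> 0 \<Longrightarrow> i + j \<le> n"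
  shows "pdeg p \<le> n"
proof (cases "p = 0")
  case False
  then show ?thesis using pdeg_attained[of p] assms by metis
qed (simp add: pdeg_def)

lemma pdeg_0 [simp]: "pdeg 0 = 0"
  by (simp add: pdeg_def)

lemma pdeg_const [simp]: "pdeg (pconst c) = 0"
proof -
  have "pdeg (pconst c) \<le> 0"
    by (rule pdeg_leI) (auto simp: pconst_def coeff_pCons split: nat.splits if_splits)
  then show ?thesis by simp
qed

lemma pdeg_X [simp]: "pdeg pX = 1"
proof (rule antisym)
  show "pdeg pX \<le> (1::nat)"
    by (rule pdeg_leI) (auto simp: pX_def coeff_pCons split: nat.splits if_splits)
  show "1 \<le> pdeg pX"
    using pdeg_ge[of pX 0 1] by (simp add: pX_def)
qed

lemma pdeg_Y [simp]: "pdeg pY = 1"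
proof (rule antisym)
  show "pdeg pY \<le> (1::nat)"
    by (rule pdeg_leI) (auto simp: pY_def coeff_pCons of_bool_def split: nat.splits if_splits)
  show "1 \<le> pdeg pY"
    using pdeg_ge[of pY 1 0] by (simp add: pY_def)
qed

lemma pdeg_add_le: "pdeg p \<le> n \<Longrightarrow> pdeg q \<le> n \<Longrightarrow> pdeg (p + q) \<le> n"
proof (rule pdeg_leI)
  fix i j assume a: "pdeg p \<le> n" "pdeg q \<le> n" and "coeff (coeff (p + q) j) i \<noteq> 0"
  then have "coeff (coeff p j) i \<noteq> 0 \<or> coeff (coeff q j) i \<noteq> 0" by auto
  then show "i + j \<le> n" using a pdeg_ge order_trans by blast
qed

lemma pdeg_uminus [simp]: "pdeg (- p) = pdeg p"
  by (simp add: pdeg_def)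

lemma pdeg_diff_le: "pdeg p \<le> n \<Longrightarrow> pdeg q \<le> n \<Longrightarrow> pdeg (p - q) \<le> n"
  using pdeg_add_le[of p n "- q"] by simp

lemma pdeg_sum_le: "(\<And>i. i \<in> A \<Longrightarrow> pdeg (F i) \<le> n) \<Longrightarrow> pdeg (sum F A) \<le> n"
  by (induction A rule: infinite_finite_induct) (simp_all add: pdeg_add_le)

text \<open>Only an inequality, since the convention \<open>pdeg 0 = 0\<close> breaks additivity
  when a factor is 0.\<close>

lemma pdeg_mult_le: "pdeg (p * q) \<le> pdeg p + pdeg q"
  using pdeg_mult[of p q] by (cases "p = 0"; cases "q = 0") simp_all

lemma pdeg_power_le: "pdeg (p ^ n) \<le> n * pdeg p"
proof (induction n)
  case 0
  then show ?case using pdeg_const[of 1] by (simp add: pconst_def flip: one_pCons)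
next
  case (Suc n)
  then show ?case using pdeg_mult_le[of p "p ^ n"] by simp
qed

lemma pdeg_prod:
  "(\<And>i. i \<in> A \<Longrightarrow> F i \<noteq> 0) \<Longrightarrow> pdeg (prod F A) = (\<Sum>i\<in>A. pdeg (F i))"
proof (induction A rule: infinite_finite_induct)
  case (insert x A)
  then show ?case by (simp add: pdeg_mult)
next
  case (infinite A)
  then show ?case using pdeg_const[of 1] by (simp add: pconst_def flip: one_pCons)
next
  case empty
  then show ?case using pdeg_const[of 1] by (simp add: pconst_def flip: one_pCons)
qed

lemma pdeg_add_const:
  assumes "pdeg p \<noteq> 0"
  shows "pdeg (p + pconst c) = pdeg p"
proof (rule antisym)
  show "pdeg (p + pconst c) \<le> pdeg p" by (rule pdeg_add_le) simp_all
  have "pdeg ((p + pconst c) - pconst c) \<le> pdeg (p + pconst c)"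
    by (rule pdeg_diff_le) simp_all
  then show "pdeg p \<le> pdeg (p + pconst c)" by simp
qed

lemma pdeg_eq_0: "pdeg p = 0 \<longleftrightarrow> (\<exists>c. p = pconst c)"
proof
  assume 0: "pdeg p = 0"
  have "p = pconst (coeff (coeff p 0) 0)"
    using pdeg_ge[of p] unfolding 0
    by (intro poly_eqI) (auto simp: pconst_def coeff_pCons split: nat.split)
  then show "\<exists>c. p = pconst c" by blast
qed auto

section \<open>Constants and units\<close>

lemma pconst_mult: "pconst (a * b) = pconst a * pconst b"
  by (simp add: pconst_def)

lemma pconst_diff: "pconst (a - b) = pconst a - pconst b"
  by (simp add: pconst_def)

lemma pconst_1 [simp]: "pconst 1 = 1"
  by (simp add: pconst_def flip: one_pCons)

lemma pconst_eq_0 [simp]: "pconst c = 0 \<longleftrightarrow> c = 0" "pconst 0 = 0"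
  by (auto simp: pconst_def)

lemma is_unit_pconst: "c \<noteq> 0 \<Longrightarrow> is_unit (pconst c)"
  by (rule dvdI[of _ _ "pconst (inverse c)"]) (simp flip: pconst_mult)

text \<open>Constants are zero or units. Dividing by a prime therefore lowers the degree, which
  drives the two inductions on degree below.\<close>

lemma pdeg_prime: "prime_elem p \<Longrightarrow> pdeg p \<noteq> 0"
  by (metis is_unit_pconst pdeg_eq_0 pconst_eq_0(1) prime_elem_def)

section \<open>Poles of rational functions\<close>

text \<open>Repeated division by \<open>p\<close> stops because each division strictly lowers the
  total degree.\<close>

lemma prime_power_decomposition:
  assumes p: "prime_elem (p :: 'k::field_char_0 poly2)" and "s \<noteq> 0"
  shows "\<exists>n s'. \<not> p dvd s' \<and> s = p ^ n * s'"
  using assms(2)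
proof (induction "pdeg s" arbitrary: s rule: less_induct)
  case less
  show ?case
  proof (cases "p dvd s")
    case True
    then obtain r where r: "s = p * r" by blast
    then have "r \<noteq> 0" "p \<noteq> 0" using less.prems by auto
    then have "pdeg r < pdeg s" using pdeg_mult[of p r] pdeg_prime[OF p] r by simp
    then obtain n s' where "\<not> p dvd s'" "r = p ^ n * s'" using less.hyps \<open>r \<noteq> 0\<close> by blast
    then show ?thesis by (intro exI[of _ "Suc n"] exI[of _ s']) (simp add: r mult.assoc)
  next
    case False
    then show ?thesis by (intro exI[of _ 0] exI[of _ s]) simp
  qed
qed

lemma valeq_exists:
  assumes p: "prime_elem (p :: 'k::field_char_0 poly2)" and "u \<noteq> 0"
  shows "\<exists>n. valeq p n u"
proof -
  obtain a b where u: "u = Fraction_Field.Fract a b" "b \<noteq> 0" "a \<noteq> 0"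
    using \<open>u \<noteq> 0\<close> by (cases u rule: Fract_cases_nonzero) auto
  obtain n a' where a: "\<not> p dvd a'" "a = p ^ n * a'" using prime_power_decomposition[OF p u(3)] by blast
  obtain m b' where b: "\<not> p dvd b'" "b = p ^ m * b'" using prime_power_decomposition[OF p u(2)] by blast
  have "p \<noteq> 0" using p by auto
  have "u = to_fract a / to_fract b" using u by (simp add: to_fract_def)
  also have "\<dots> = to_fract p powi (int n - int m) * (to_fract a' / to_fract b')"
    using a b \<open>p \<noteq> 0\<close> by (simp add: to_fract_hom.hom_power power_int_diff field_simps)
  finally show ?thesis unfolding valeq_def using a b by blast
qed

lemma valeq_const:
  assumes "prime_elem p" "c \<noteq> 0"
  shows "valeq p 0 (rconst c)"
proof -
  have "\<not> p dvd pconst c"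
    using assms dvd_trans[OF _ is_unit_pconst[OF assms(2)]] by (auto simp only: prime_elem_def)
  then show ?thesis
    unfolding rconst_def emb_eq_to_fract by (rule valeq_to_fract[OF assms(1)])
qed

lemma valge_const: "prime_elem p \<Longrightarrow> valge p 0 (rconst c)"
  unfolding rconst_def emb_eq_to_fract by (rule valge_to_fract)

lemma rconst_diff: "rconst (a - b) = rconst a - rconst b"
  by (simp add: rconst_def emb_eq_to_fract pconst_diff)

lemma rconst_mult: "rconst (a * b) = rconst a * rconst b"
  by (simp add: rconst_def emb_eq_to_fract pconst_mult)

lemma rconst_0_1 [simp]: "rconst 0 = 0" "rconst 1 = 1"
  by (simp_all add: rconst_def emb_eq_to_fract)

text \<open>
  In a product over at least three distinct shifts of \<open>v\<close>, all factors but one are units if \<open>v\<close> has no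
  pole, so after a shift of \<open>v\<close> the product and \<open>v\<close> have the same valuation; the defect \<open>e\<close> is the
  surplus pole order otherwise.
\<close>

lemma valuation_linear_factors:
  fixes \<theta> :: "'i \<Rightarrow> 'k::field_char_0"
  assumes p: "prime_elem p" and A: "finite A" "inj_on \<theta> A" "3 \<le> card A"
    and nz: "\<And>j. j \<in> A \<Longrightarrow> v + rconst (\<theta> j) \<noteq> 0"
  obtains b d e where "valge p b (v + rconst d)"
    "valeq p (b - e) (\<Prod>j\<in>A. v + rconst (\<theta> j))"
    "0 \<le> e" "\<not> valge p 0 v \<longrightarrow> 2 \<le> e"
proof (cases "valge p 0 v")
  case v0: True
  have vg: "valge p 0 (v + rconst c)" for c
    using v0 by (intro valge_add[OF p] valge_const[OF p])
  show ?thesis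
  proof (cases "\<exists>j\<in>A. valge p 1 (v + rconst (\<theta> j))")
    case True
    then obtain j where j: "j \<in> A" "valge p 1 (v + rconst (\<theta> j))" by blast
    obtain b where b: "valeq p b (v + rconst (\<theta> j))" using valeq_exists[OF p nz[OF j(1)]] by blast
    \<comment> \<open>This factor is the one at \<open>j\<close>, of positive valuation, plus the
      nonzero constant \<open>\<theta> i - \<theta> j\<close>; hence it is a unit at
      \<open>p\<close>.\<close>
    have others: "valeq p 0 (v + rconst (\<theta> i))" if "i \<in> A - {j}" for i
    proof -
      have "\<theta> i - \<theta> j \<noteq> 0" using that j(1) A(2) by (auto dest: inj_onD)
      then have "valeq p 0 (rconst (\<theta> i - \<theta> j) + (v + rconst (\<theta> j)))"
        using valeq_add[OF p valeq_const[OF p]] j(2) by simp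
      then show ?thesis by (simp add: rconst_diff add.commute)
    qed
    have "valeq p (int (card (A - {j})) * 0) (\<Prod>i\<in>A - {j}. v + rconst (\<theta> i))"
      by (rule valeq_prod[OF p others])
    from valeq_mult[OF p b this] have "valeq p (b - 0) (\<Prod>j\<in>A. v + rconst (\<theta> j))"
      using A(1) j(1) by (simp add: prod.remove)
    then show ?thesis using that[of b "\<theta> j" 0] b v0 by (auto intro: valeq_imp_valge)
  next
    case False
    then have units: "valeq p 0 (v + rconst (\<theta> j))" if "j \<in> A" for j
      using that vg valge_imp_valeq[OF p, of 0] by simp
    have "valeq p (int (card A) * 0) (\<Prod>j\<in>A. v + rconst (\<theta> j))"
      by (rule valeq_prod[OF p units])
    then have "valeq p (0 - 0) (\<Prod>j\<in>A. v + rconst (\<theta> j))" by simp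
    \<comment> \<open>No factor vanishes along \<open>p\<close>, so the product is a unit and no
      shift is made.\<close>
    then show ?thesis using that[of 0 0 0] v0 by auto
  qed
next
  case False
  then have "v \<noteq> 0" using valge_0[OF p] by auto
  then obtain b where b: "valeq p b v" using valeq_exists[OF p] by blast
  have neg: "b < 0" using False valge_mono[OF p valeq_imp_valge[OF b], of 0] by force
  \<comment> \<open>The pole dominates: \<open>b + 1 \<le> 0\<close>, so constants are of higher
    order than \<open>v\<close> and every factor keeps valuation \<open>b\<close>.\<close>
  then have vg: "valge p (b + 1) (rconst c)" for c
    using valge_mono[OF p valge_const[OF p], of "b + 1"] by simp
  have pr: "valeq p (int (card A) * b) (\<Prod>j\<in>A. v + rconst (\<theta> j))"
    by (rule valeq_prod[OF p valeq_add[OF p b vg]])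
  \<comment> \<open>Chosen so that \<open>b - e\<close> is \<open>card A * b\<close>; at least three
    factors and \<open>b \<le> -1\<close> give \<open>e \<ge> 2\<close>.\<close>
  define e where "e = (int (card A) - 1) * (- b)"
  have "2 * 1 \<le> e" unfolding e_def using A(3) neg by (intro mult_mono) auto
  moreover have "b - e = int (card A) * b" by (simp add: e_def algebra_simps)
  ultimately show ?thesis using that[of b 0 e] pr valeq_imp_valge[OF b] by simp
qed

text \<open>Regularity at a prime factor of the denominator forces that prime to divide the
  numerator too. Cancelling it lowers the degree of the denominator, until the denominator is a
  unit.\<close>

lemma no_poles_imp_polynomial:
  fixes u :: "'k::field_char_0 rat2"
  assumes "\<And>p. prime_elem p \<Longrightarrow> valge p 0 u"
  shows "\<exists>q. u = emb q"
proof -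
  have "\<exists>q. Fraction_Field.Fract a b = emb q"
    if "\<And>p. prime_elem p \<Longrightarrow> valge p 0 (Fraction_Field.Fract a b)" "b \<noteq> 0" for a b :: "'k poly2"
    using that
  proof (induction "pdeg b" arbitrary: a b rule: less_induct)
    case less
    show ?case
    proof (cases "is_unit b")
      case True
      then obtain b' where "1 = b * b'" by blast
      then have "Fraction_Field.Fract a b = emb (a * b')"
        using less.prems(2) by (simp add: emb_def eq_fract mult_ac)
      then show ?thesis by blast
    next
      case False
      then obtain F where F: "mset_factors F b" using mset_factors_exist less.prems(2) by blast
      then obtain p where "p \<in># F" by (auto simp: mset_factors_def)
      then have "irreducible p" using F by (simp add: mset_factors_def)
      \<comment> \<open>Irreducible elements are prime because \<open>k[x,y]\<close> is
        factorial.\<close>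
      then have p: "prime_elem p" by simp
      have "p dvd b" by (rule mset_factors_imp_dvd[OF F \<open>p \<in># F\<close>])
      then obtain r where r: "b = p * r" by blast
      obtain s t where st: "\<not> p dvd t" "Fraction_Field.Fract a b = to_fract s / to_fract t"
        using less.prems(1)[OF p] unfolding valge_def by auto
      have "t \<noteq> 0" using st by auto
      then have "a * t = s * b"
        using st(2) less.prems(2) by (simp add: to_fract_def eq_fract)
      then have "p dvd a * t" using r by simp
      then have "p dvd a" using p st(1) by (simp add: prime_elem_dvd_mult_iff)
      then obtain a' where a': "a = p * a'" by blast
      have nz: "p \<noteq> 0" "r \<noteq> 0" using r less.prems(2) by auto
      then have eq: "Fraction_Field.Fract a b = Fraction_Field.Fract a' r"
        unfolding a' r by (simp add: mult_fract_cancel)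
      have "pdeg r < pdeg b" using r pdeg_mult[OF nz] pdeg_prime[OF p] by simp
      then show ?thesis using less.hyps[of r a'] less.prems(1) nz(2) unfolding eq by metis
    qed
  qed
  moreover obtain a b where "u = Fraction_Field.Fract a b" "b \<noteq> 0" by (cases u)
  ultimately show ?thesis using assms by metis
qed

section \<open>The Jacobian of two polynomials\<close>

text \<open>Truncated subtraction is harmless: a constant has derivative 0, which has degree 0 by
  convention.\<close>

lemma pdeg_pdx_le: "pdeg (pdx p) \<le> pdeg p - 1"
proof (rule pdeg_leI)
  fix i j assume "coeff (coeff (pdx p) j) i \<noteq> 0"
  then have "coeff (coeff p j) (Suc i) \<noteq> 0"
    by (auto simp: pdx_def coeff_map_poly coeff_pderiv)
  from pdeg_ge[OF this] show "i + j \<le> pdeg p - 1" by simp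
qed

lemma pdeg_pdy_le: "pdeg (pdy p) \<le> pdeg p - 1"
proof (rule pdeg_leI)
  fix i j assume "coeff (coeff (pdy p) j) i \<noteq> 0"
  then have "coeff (coeff p (Suc j)) i \<noteq> 0"
    by (auto simp: pdy_def coeff_pderiv of_nat_poly simp del: of_nat_Suc)
  from pdeg_ge[OF this] show "i + j \<le> pdeg p - 1" by simp
qed

definition pjac :: "'k::field_char_0 poly2 \<Rightarrow> 'k poly2 \<Rightarrow> 'k poly2"
  where "pjac U V = pdx U * pdy V - pdy U * pdx V"

lemma jac_emb: "jac (emb U) (emb V) = emb (pjac U V)"
  by (simp add: jac_def pjac_def rd_emb) (simp add: emb_eq_to_fract)

lemma pdeg_pjac_le: "pdeg (pjac U V) \<le> (pdeg U - 1) + (pdeg V - 1)"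
  unfolding pjac_def
  by (intro pdeg_diff_le order.trans[OF pdeg_mult_le] add_mono pdeg_pdx_le pdeg_pdy_le)

text \<open>Constants have zero derivatives. With both degrees positive, the subtractions in
  \<open>pdeg_pjac_le\<close> are genuine.\<close>

lemma pjac_nonconst:
  assumes "pjac U V \<noteq> 0"
  shows "pdeg U \<noteq> 0" "pdeg V \<noteq> 0"
  using assms by (auto simp: pdeg_eq_0 pjac_def)

lemma pd_XY [simp]: "pdx pX = 1" "pdy pX = 0" "pdx pY = 0" "pdy pY = 1"
  by (auto simp: pdx_def pdy_def pX_def pY_def pderiv_pCons coeff_map_poly coeff_pCons
      intro!: poly_eqI split: nat.split)

lemma pjac_affine:
  "pjac (pconst a * pX + pconst b * pY + pconst e) (pconst a' * pX + pconst b' * pY + pconst e')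
    = pconst (a * b' - b * a')"
  by (simp add: pjac_def pdx_add pdy_add pdx_mult pdy_mult pconst_diff pconst_mult)

lemma pdeg_le_1_imp_affine:
  assumes "pdeg U \<le> 1"
  obtains a b e where "U = pconst a * pX + pconst b * pY + pconst e"
proof -
  define a b e where "a = coeff (coeff U 0) 1" and "b = coeff (coeff U 1) 0"
    and "e = coeff (coeff U 0) 0"
  have z: "coeff (coeff U j) i = 0" if "1 < i + j" for i j
    using pdeg_ge[of U j i] assms that by force
  \<comment> \<open>The outer list is in \<open>y\<close>, the inner ones in \<open>x\<close>, so
    this is \<open>e + a x + b y\<close>.\<close>
  have "coeff (coeff U j) i = coeff (coeff [:[:e, a:], [:b:]:] j) i" for i j
    using z[of i j] by (auto simp: a_def b_def e_def coeff_pCons split: nat.split)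
  then have "U = [:[:e, a:], [:b:]:]" by (intro poly_eqI)
  also have "\<dots> = pconst a * pX + pconst b * pY + pconst e"
    by (simp add: pconst_def pX_def pY_def)
  finally show ?thesis using that by blast
qed

text \<open>A constant shift keeps a positive degree, so no factor vanishes and degrees add. It is
  applied both to \<open>f\<close> itself, with \<open>pX\<close> and \<open>pY\<close>, and to its
  image, with the images of the variables.\<close>

lemma pdeg_linear_product:
  fixes U V :: "'k::field_char_0 poly2"
  assumes "finite A" "finite B" "pdeg U \<noteq> 0" "pdeg V \<noteq> 0" "c \<noteq> 0"
  shows "pdeg (pconst c * (\<Prod>i\<in>A. U + pconst (\<xi> i)) * (\<Prod>j\<in>B. V + pconst (\<eta> j)))
    = card A * pdeg U + card B * pdeg V"
proof -
  have nz: "W + pconst d \<noteq> 0" if "pdeg W \<noteq> 0" for W :: "'k poly2" and d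
    using pdeg_add_const[OF that, of d] that by auto
  have "(\<Prod>i\<in>A. U + pconst (\<xi> i)) \<noteq> 0" "(\<Prod>j\<in>B. V + pconst (\<eta> j)) \<noteq> 0"
    using nz assms(1-4) by auto
  then show ?thesis
    using assms(3,4) nz by (simp add: pdeg_mult pdeg_prod pdeg_add_const assms(5))
qed

section \<open>Polynomials inside the rational function field\<close>

lemma emb_simps:
  "emb (p + q) = emb p + emb q" "emb (p - q) = emb p - emb q" "emb (p * q) = emb p * emb q"
  "emb (p ^ n) = emb p ^ n" "emb 0 = 0" "emb 1 = 1" "emb (pconst c) = rconst c"
  "emb pX = rX" "emb pY = rY"
  by (simp_all add: emb_eq_to_fract rconst_def rX_def rY_def to_fract_hom.hom_power)

lemma emb_sum: "emb (sum F A) = (\<Sum>i\<in>A. emb (F i))"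
  by (simp add: emb_eq_to_fract to_fract_hom.hom_sum)

lemma emb_prod: "emb (prod F A) = (\<Prod>i\<in>A. emb (F i))"
  by (simp add: emb_eq_to_fract to_fract_hom.hom_prod)

lemma emb_eq_iff [simp]: "emb p = emb q \<longleftrightarrow> p = q"
  by (simp add: emb_eq_to_fract)

lemma emb_eq_0 [simp]: "emb p = 0 \<longleftrightarrow> p = 0"
  by (simp add: emb_eq_to_fract)

lemma rat2_quotient:
  fixes u :: "'k::field_char_0 rat2"
  obtains a b where "b \<noteq> 0" "u = emb a / emb b"
  by (cases u) (auto simp: emb_def)

section \<open>Algebra homomorphisms of the rational function field\<close>

lemma alg_homD:
  assumes "alg_hom e e' \<phi>"
  shows "\<phi> (a + b) = \<phi> a + \<phi> b" "\<phi> (a * b) = \<phi> a * \<phi> b" "\<phi> (e c) = e' c" "\<phi> 1 = 1"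
  using assms by (simp_all add: alg_hom_def)

lemma alg_hom_0: "alg_hom e e' \<phi> \<Longrightarrow> \<phi> 0 = 0"
  by (metis alg_homD(1) add_cancel_right_right)

lemma alg_hom_sum: "alg_hom e e' \<phi> \<Longrightarrow> \<phi> (sum F A) = (\<Sum>i\<in>A. \<phi> (F i))"
  by (induction A rule: infinite_finite_induct) (simp_all add: alg_hom_0 alg_homD)

lemma alg_hom_prod: "alg_hom e e' \<phi> \<Longrightarrow> \<phi> (prod F A) = (\<Prod>i\<in>A. \<phi> (F i))"
  by (induction A rule: infinite_finite_induct) (simp_all add: alg_homD)

lemma alg_hom_power: "alg_hom e e' \<phi> \<Longrightarrow> \<phi> (x ^ n) = \<phi> x ^ n"
  by (induction n) (simp_all add: alg_homD)

lemma alg_hom_eq_0: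
  fixes \<phi> :: "'a::field \<Rightarrow> 'b::field"
  assumes "alg_hom e e' \<phi>"
  shows "\<phi> x = 0 \<longleftrightarrow> x = 0"
proof
  assume "\<phi> x = 0"
  then have "x \<noteq> 0 \<Longrightarrow> \<phi> (x * inverse x) = 0" by (simp only: alg_homD[OF assms] mult_zero_left)
  then show "x = 0" using alg_homD(4)[OF assms] by force
qed (simp add: alg_hom_0[OF assms])

lemma alg_hom_divide:
  fixes \<phi> :: "'a::field \<Rightarrow> 'b::field"
  assumes "alg_hom e e' \<phi>"
  shows "\<phi> (x / y) = \<phi> x / \<phi> y"
proof (cases "y = 0")
  case False
  then have "\<phi> (x / y) * \<phi> y = \<phi> x" by (simp flip: alg_homD(2)[OF assms])
  then show ?thesis using False by (simp add: alg_hom_eq_0[OF assms] field_simps)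
qed (simp add: alg_hom_0[OF assms])

lemma alg_hom_inj:
  fixes \<phi> :: "'a::field \<Rightarrow> 'b::field"
  assumes "alg_hom e e' \<phi>"
  shows "inj \<phi>"
proof (rule injI)
  fix x y assume "\<phi> x = \<phi> y"
  then have "\<phi> (x - y) = 0"
    using alg_homD(1)[OF assms, of "x - y" y] by simp
  then show "x = y" by (simp add: alg_hom_eq_0[OF assms])
qed

text \<open>Exhibits \<open>p\<close> as an expression in the generators, so that a homomorphism can
  be evaluated from its values at the two variables.\<close>

lemma poly2_expand:
  "p = (\<Sum>j\<le>degree p. \<Sum>i\<le>degree (coeff p j). pconst (coeff (coeff p j) i) * pX ^ i * pY ^ j)"
proof -
  have Y: "monom q j = [:q:] * pY ^ j" for q :: "'a poly" and j
    by (simp add: monom_altdef pY_def)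
  have X: "[:monom c i:] = pconst c * pX ^ i" for c :: 'a and i
  proof (induction i)
    case (Suc i)
    have "[:monom c (Suc i):] = pX * [:monom c i:]" by (simp add: pX_def monom_Suc)
    then show ?case by (simp add: Suc)
  qed (simp add: pconst_def monom_0)
  have S: "[:sum F A:] = (\<Sum>i\<in>A. [:F i:])" for F :: "nat \<Rightarrow> 'a poly" and A
  proof (induction A rule: infinite_finite_induct)
    case (insert x A)
    have "[:F x + sum F A:] = [:F x:] + [:sum F A:]" by simp
    then show ?case using insert by simp
  qed simp_all
  have C: "[:q:] = (\<Sum>i\<le>degree q. pconst (coeff q i) * pX ^ i)" for q :: "'a poly"
    by (subst (1) poly_as_sum_of_monoms[symmetric]) (simp add: S X)
  have "p = (\<Sum>j\<le>degree p. monom (coeff p j) j)"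
    by (rule poly_as_sum_of_monoms[symmetric])
  also have "\<dots> = (\<Sum>j\<le>degree p. \<Sum>i\<le>degree (coeff p j).
      pconst (coeff (coeff p j) i) * pX ^ i * pY ^ j)"
    by (simp add: Y C sum_distrib_right)
  finally show ?thesis .
qed

text \<open>The double sum is the substitution \<open>p(U, V)\<close>.\<close>

lemma alg_hom_emb:
  assumes \<phi>: "alg_hom rconst rconst \<phi>" and U: "\<phi> rX = emb U" and V: "\<phi> rY = emb V"
  shows "\<phi> (emb p) = emb (\<Sum>j\<le>degree p. \<Sum>i\<le>degree (coeff p j).
    pconst (coeff (coeff p j) i) * U ^ i * V ^ j)"
  by (subst poly2_expand[of p])
    (simp add: emb_sum emb_simps alg_hom_sum[OF \<phi>] alg_homD[OF \<phi>] alg_hom_power[OF \<phi>] U V)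

text \<open>Substituting polynomials of degree at most 1 turns a monomial of degree
  \<open>i + j\<close> into a polynomial of degree at most \<open>i + j\<close>.\<close>

lemma alg_hom_emb_pdeg_le:
  assumes \<phi>: "alg_hom rconst rconst \<phi>" and U: "\<phi> rX = emb U" and V: "\<phi> rY = emb V"
    and deg: "pdeg U \<le> 1" "pdeg V \<le> 1"
  obtains q where "\<phi> (emb p) = emb q" "pdeg q \<le> pdeg p"
proof (rule that[OF alg_hom_emb[OF \<phi> U V]], intro pdeg_sum_le)
  fix i j
  show "pdeg (pconst (coeff (coeff p j) i) * U ^ i * V ^ j) \<le> pdeg p"
  proof (cases "coeff (coeff p j) i = 0")
    case False
    have "pdeg (U ^ i) \<le> i" "pdeg (V ^ j) \<le> j"
      using deg pdeg_power_le[of U i] pdeg_power_le[of V j]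
      by (metis mult.right_neutral mult_le_mono2 order.trans)+
    moreover have "pdeg (pconst (coeff (coeff p j) i) * U ^ i * V ^ j) \<le> pdeg (U ^ i) + pdeg (V ^ j)"
      using pdeg_mult_le[of "pconst (coeff (coeff p j) i) * U ^ i" "V ^ j"]
        pdeg_mult_le[of "pconst (coeff (coeff p j) i)" "U ^ i"] by simp
    ultimately show ?thesis using pdeg_ge[OF False] by linarith
  qed simp
qed

section \<open>Poisson morphisms\<close>

text \<open>Preservation of the bracket at the single pair \<open>rX\<close>, \<open>rY\<close>,
  whose bracket is \<open>f\<close>.\<close>

lemma poisson_morphism_jac:
  assumes "poisson_morphism f g \<phi>"
  shows "jac (\<phi> rX) (\<phi> rY) * g = \<phi> f"
  using assms by (metis jac_def pbracket_X_Y pbracket_def poisson_morphism_def)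

lemma alg_hom_linear_product:
  assumes "alg_hom rconst rconst \<phi>"
  shows "\<phi> (emb (pconst c * (\<Prod>i\<in>A. pX + pconst (\<xi> i)) * (\<Prod>j\<in>B. pY + pconst (\<eta> j))))
    = rconst c * (\<Prod>i\<in>A. \<phi> rX + rconst (\<xi> i)) * (\<Prod>j\<in>B. \<phi> rY + rconst (\<eta> j))"
  by (simp add: emb_simps emb_prod alg_hom_prod[OF assms] alg_homD[OF assms])

text \<open>At a prime \<open>p\<close>, the Jacobian bounds the valuation of
  \<open>\<phi> (emb f)\<close> below by \<open>b + b' - 1\<close>, while the product formula gives
  exactly \<open>b - e + b' - e'\<close>. Hence \<open>e + e' \<le> 1\<close>, whereas a pole of
  either image would make its defect at least 2.\<close>

lemma poisson_morphism_polynomial: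
  fixes g :: "'k::field_char_0 poly2"
  assumes \<phi>: "poisson_morphism (emb f) (emb g) \<phi>"
    and f: "f = pconst c * (\<Prod>i\<in>A. pX + pconst (\<xi> i)) * (\<Prod>j\<in>B. pY + pconst (\<eta> j))"
    and c: "c \<noteq> 0" and A: "finite A" "inj_on \<xi> A" "3 \<le> card A"
    and B: "finite B" "inj_on \<eta> B" "3 \<le> card B"
  obtains U V where "\<phi> rX = emb U" "\<phi> rY = emb V"
proof -
  have hom: "alg_hom rconst rconst \<phi>" using \<phi> by (simp add: poisson_morphism_def)
  have nz: "\<phi> rX + rconst d \<noteq> 0" "\<phi> rY + rconst d \<noteq> 0" for d
  proof -
    have "pX + pconst d \<noteq> 0" "pY + pconst d \<noteq> 0"
      using pdeg_add_const[of pX d] pdeg_add_const[of pY d] by auto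
    then have "\<phi> (emb (pX + pconst d)) \<noteq> 0" "\<phi> (emb (pY + pconst d)) \<noteq> 0"
      by (simp_all add: alg_hom_eq_0[OF hom])
    then show "\<phi> rX + rconst d \<noteq> 0" "\<phi> rY + rconst d \<noteq> 0"
      by (simp_all add: emb_simps alg_homD[OF hom])
  qed
  have nzA: "\<phi> rX + rconst (\<xi> i) \<noteq> 0" if "i \<in> A" for i by (rule nz)
  have nzB: "\<phi> rY + rconst (\<eta> j) \<noteq> 0" if "j \<in> B" for j by (rule nz)
  have "valge p 0 (\<phi> rX) \<and> valge p 0 (\<phi> rY)" if p: "prime_elem p" for p
  proof -
    obtain b d e where 1: "valge p b (\<phi> rX + rconst d)"
      "valeq p (b - e) (\<Prod>i\<in>A. \<phi> rX + rconst (\<xi> i))" "0 \<le> e" "\<not> valge p 0 (\<phi> rX) \<longrightarrow> 2 \<le> e"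
      by (rule valuation_linear_factors[OF p A nzA])
    obtain b' d' e' where 2: "valge p b' (\<phi> rY + rconst d')"
      "valeq p (b' - e') (\<Prod>j\<in>B. \<phi> rY + rconst (\<eta> j))" "0 \<le> e'" "\<not> valge p 0 (\<phi> rY) \<longrightarrow> 2 \<le> e'"
      by (rule valuation_linear_factors[OF p B nzB])
    have "valge p (b + b' - 1) (jac (\<phi> rX) (\<phi> rY))"
      using valge_jac[OF p 1(1) 2(1)] by (simp add: jac_add_const)
    \<comment> \<open>The summand 0 is the contribution of \<open>g\<close>, which has no
      pole.\<close>
    then have "valge p ((b + b' - 1) + 0) (\<phi> (emb f))"
      unfolding poisson_morphism_jac[OF \<phi>, symmetric] emb_eq_to_fract[of g]
      by (intro valge_mult[OF p] valge_to_fract[OF p])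
    moreover have "valeq p ((0 + (b - e)) + (b' - e')) (\<phi> (emb f))"
      unfolding f alg_hom_linear_product[OF hom]
      by (intro valeq_mult[OF p] valeq_const[OF p c] 1 2)
    ultimately have "\<not> (0 + (b - e)) + (b' - e') < (b + b' - 1) + 0"
      using valeq_imp_not_valge[OF p] by blast
    then show ?thesis using 1(3,4) 2(3,4) by linarith
  qed
  then show ?thesis using that no_poles_imp_polynomial by meson
qed

text \<open>Inverting the affine substitution gives preimages of both variables, hence of all
  polynomials and of all quotients; injectivity is automatic for fields.\<close>

lemma affine_alg_hom_inverse:
  fixes \<phi> :: "'k::field_char_0 rat2 \<Rightarrow> 'k rat2"
  assumes \<phi>: "alg_hom rconst rconst \<phi>"
    and X: "\<phi> rX = rconst a * rX + rconst b * rY + rconst e"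
    and Y: "\<phi> rY = rconst a' * rX + rconst b' * rY + rconst e'"
    and D: "a * b' - b * a' \<noteq> 0"
  shows "bij \<phi>"
    and "\<exists>U V. inv_into UNIV \<phi> rX = emb U \<and> inv_into UNIV \<phi> rY = emb V \<and> pdeg U \<le> 1 \<and> pdeg V \<le> 1"
proof -
  define r where "r = inverse (a * b' - b * a')"
  \<comment> \<open>\<open>U\<close> and \<open>V\<close> solve the two affine equations for the
    variables by Cramer's rule, with \<open>r\<close> the inverse determinant.\<close>
  define U where "U = pconst r * (pconst b' * (pX - pconst e) - pconst b * (pY - pconst e'))"
  define V where "V = pconst r * (pconst a * (pY - pconst e') - pconst a' * (pX - pconst e))"
  have \<phi>_minus: "\<phi> (x - y) = \<phi> x - \<phi> y" for x y
    using alg_homD(1)[OF \<phi>, of "x - y" y] by (simp add: eq_diff_eq)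
  have det: "rconst r * (rconst a * rconst b' - rconst b * rconst a') = 1"
    using D unfolding rconst_mult[symmetric] rconst_diff[symmetric] by (simp add: r_def)
  have "\<phi> (emb U) = rconst r * (rconst a * rconst b' - rconst b * rconst a') * rX"
    by (simp add: U_def emb_simps \<phi>_minus alg_homD[OF \<phi>] X Y algebra_simps)
  then have \<phi>U: "\<phi> (emb U) = rX" by (simp add: det)
  have "\<phi> (emb V) = rconst r * (rconst a * rconst b' - rconst b * rconst a') * rY"
    by (simp add: V_def emb_simps \<phi>_minus alg_homD[OF \<phi>] X Y algebra_simps)
  then have \<phi>V: "\<phi> (emb V) = rY" by (simp add: det)
  have poly: "\<exists>x. \<phi> x = emb p" for p
  proof
    \<comment> \<open>The preimage of \<open>p\<close> is \<open>p(U, V)\<close>.\<close>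
    have "\<phi> (\<Sum>j\<le>degree p. \<Sum>i\<le>degree (coeff p j).
        rconst (coeff (coeff p j) i) * emb U ^ i * emb V ^ j)
      = emb (\<Sum>j\<le>degree p. \<Sum>i\<le>degree (coeff p j). pconst (coeff (coeff p j) i) * pX ^ i * pY ^ j)"
      by (simp add: emb_sum emb_simps alg_hom_sum[OF \<phi>] alg_homD[OF \<phi>] alg_hom_power[OF \<phi>] \<phi>U \<phi>V)
    then show "\<phi> (\<Sum>j\<le>degree p. \<Sum>i\<le>degree (coeff p j).
        rconst (coeff (coeff p j) i) * emb U ^ i * emb V ^ j) = emb p"
      unfolding poly2_expand[of p, symmetric] .
  qed
  have "\<exists>x. \<phi> x = w" for w
  proof -
    obtain p q where "w = emb p / emb q" by (rule rat2_quotient)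
    then show ?thesis using poly[of p] poly[of q] alg_hom_divide[OF \<phi>] by metis
  qed
  then have "surj \<phi>" by (metis surjI)
  then show bij: "bij \<phi>" using alg_hom_inj[OF \<phi>] by (simp add: bij_def)
  have "pdeg (pconst s * (pconst t * (p - pconst u) - pconst t' * (q - pconst u'))) \<le> 1"
    if "pdeg p \<le> 1" "pdeg q \<le> 1" for s t u t' u' :: 'k and p q
  proof -
    have m: "pdeg (pconst x * w) \<le> 1" if "pdeg w \<le> 1" for x :: 'k and w
      using pdeg_mult_le[of "pconst x" w] that by simp
    show ?thesis by (intro m pdeg_diff_le that) simp_all
  qed
  then have "pdeg U \<le> 1" "pdeg V \<le> 1" by (simp_all add: U_def V_def)
  moreover have "inv_into UNIV \<phi> rX = emb U" "inv_into UNIV \<phi> rY = emb V"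
    using \<phi>U \<phi>V bij by (metis bij_inv_eq_iff)+
  ultimately show "\<exists>U V. inv_into UNIV \<phi> rX = emb U \<and> inv_into UNIV \<phi> rY = emb V \<and> pdeg U \<le> 1 \<and> pdeg V \<le> 1"
    by blast
qed

text \<open>An affine substitution cannot raise the degree, and neither can its inverse, which is
  affine as well.\<close>

lemma affine_alg_hom_pdeg:
  fixes \<phi> :: "'k::field_char_0 rat2 \<Rightarrow> 'k rat2"
  assumes \<phi>: "alg_hom rconst rconst \<phi>"
    and X: "\<phi> rX = rconst a * rX + rconst b * rY + rconst e"
    and Y: "\<phi> rY = rconst a' * rX + rconst b' * rY + rconst e'"
    and D: "a * b' - b * a' \<noteq> 0"
  obtains q where "\<phi> (emb p) = emb q" "pdeg q = pdeg p"
proof -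
  note inverse = affine_alg_hom_inverse[OF assms]
  have aff: "pdeg (pconst u * pX + pconst v * pY + pconst w) \<le> 1" for u v w :: 'k
    by (intro pdeg_add_le order.trans[OF pdeg_mult_le]) simp_all
  obtain q where q: "\<phi> (emb p) = emb q" "pdeg q \<le> pdeg p"
    by (rule alg_hom_emb_pdeg_le[OF \<phi> _ _ aff aff]) (simp_all add: X Y emb_simps)
  have inv: "alg_hom rconst rconst (inv_into UNIV \<phi>)" by (rule alg_hom_inv[OF \<phi> inverse(1)])
  obtain U V where UV: "inv_into UNIV \<phi> rX = emb U" "inv_into UNIV \<phi> rY = emb V" "pdeg U \<le> 1" "pdeg V \<le> 1"
    using inverse(2) by blast
  obtain p' where p': "inv_into UNIV \<phi> (emb q) = emb p'" "pdeg p' \<le> pdeg q"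
    by (rule alg_hom_emb_pdeg_le[OF inv UV])
  have "inv_into UNIV \<phi> (emb q) = emb p"
    using q(1) inverse(1) by (simp add: bij_is_inj inv_f_eq)
  then have "p' = p" using p'(1) by simp
  then show ?thesis using that q p'(2) by simp
qed

lemma affine_alg_hom_rdeg:
  fixes \<phi> :: "'k::field_char_0 rat2 \<Rightarrow> 'k rat2"
  assumes \<phi>: "alg_hom rconst rconst \<phi>"
    and X: "\<phi> rX = rconst a * rX + rconst b * rY + rconst e"
    and Y: "\<phi> rY = rconst a' * rX + rconst b' * rY + rconst e'"
    and D: "a * b' - b * a' \<noteq> 0" and u: "u \<noteq> 0"
  shows "rdeg (\<phi> u) = rdeg u"
proof -
  obtain p q where pq: "u = Fraction_Field.Fract p q" "q \<noteq> 0" "p \<noteq> 0"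
    using u by (cases u rule: Fract_cases_nonzero) auto
  obtain p' where p': "\<phi> (emb p) = emb p'" "pdeg p' = pdeg p"
    using affine_alg_hom_pdeg[OF \<phi> X Y D] by blast
  obtain q' where q': "\<phi> (emb q) = emb q'" "pdeg q' = pdeg q"
    using affine_alg_hom_pdeg[OF \<phi> X Y D] by blast
  have "emb p' \<noteq> 0" "emb q' \<noteq> 0"
    using pq alg_hom_eq_0[OF \<phi>] by (simp_all flip: p'(1) q'(1))
  then have nz: "p' \<noteq> 0" "q' \<noteq> 0" by simp_all
  have "u = emb p / emb q" using pq by (simp add: emb_def)
  then have "\<phi> u = emb p' / emb q'" by (simp add: alg_hom_divide[OF \<phi>] p' q')
  then have "\<phi> u = Fraction_Field.Fract p' q'" by (simp add: emb_def)
  then show ?thesis using pq nz p' q' by (simp add: rdeg_Fract)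
qed

text \<open>Let the images of the variables have degrees \<open>k + 1\<close> and
  \<open>l + 1\<close>. The Jacobian has degree at most \<open>k + l\<close>, while the product has
  degree \<open>card A * (k + 1) + card B * (l + 1)\<close>. Since both cardinalities are at least
  3, \<open>pdeg g\<close> exceeds \<open>pdeg f\<close> by at least \<open>2 * k + 2 * l\<close>,
  so equality forces \<open>k = l = 0\<close>.\<close>

lemma poisson_morphism_degree:
  fixes g :: "'k::field_char_0 poly2"
  assumes \<phi>: "poisson_morphism (emb f) (emb g) \<phi>" and g: "g \<noteq> 0"
    and f: "f = pconst c * (\<Prod>i\<in>A. pX + pconst (\<xi> i)) * (\<Prod>j\<in>B. pY + pconst (\<eta> j))"
    and c: "c \<noteq> 0" and A: "finite A" "inj_on \<xi> A" "3 \<le> card A"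
    and B: "finite B" "inj_on \<eta> B" "3 \<le> card B"
  obtains U V where "\<phi> rX = emb U" "\<phi> rY = emb V" "\<phi> (emb f) = emb (pjac U V * g)"
    "pjac U V \<noteq> 0" "pdeg f \<le> pdeg g" "pdeg f = pdeg g \<Longrightarrow> pdeg U \<le> 1 \<and> pdeg V \<le> 1"
proof -
  have hom: "alg_hom rconst rconst \<phi>" using \<phi> by (simp add: poisson_morphism_def)
  obtain U V where UV: "\<phi> rX = emb U" "\<phi> rY = emb V"
    using poisson_morphism_polynomial[OF \<phi> f c A B] .
  have \<phi>f: "\<phi> (emb f) = emb (pjac U V * g)"
    using poisson_morphism_jac[OF \<phi>] by (simp add: UV jac_emb emb_simps)
  have deg_f: "pdeg f = card A + card B"
    unfolding f using pdeg_linear_product[OF A(1) B(1) _ _ c, of pX pY] by simp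
  have "f \<noteq> 0" using deg_f A(3) by auto
  then have "\<phi> (emb f) \<noteq> 0" by (simp add: alg_hom_eq_0[OF hom])
  then have J: "pjac U V \<noteq> 0" unfolding \<phi>f by auto
  note UV0 = pjac_nonconst[OF J]
  have "emb (pjac U V * g) = emb (pconst c * (\<Prod>i\<in>A. U + pconst (\<xi> i)) * (\<Prod>j\<in>B. V + pconst (\<eta> j)))"
    unfolding \<phi>f[symmetric] unfolding f alg_hom_linear_product[OF hom]
    by (simp add: UV emb_simps emb_prod)
  then have sum: "pdeg (pjac U V) + pdeg g = card A * pdeg U + card B * pdeg V"
    using pdeg_linear_product[OF A(1) B(1) UV0 c] pdeg_mult[OF J g] by simp
  obtain k l where kl: "pdeg U = Suc k" "pdeg V = Suc l"
    using UV0 not0_implies_Suc by blast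
  have "pdeg (pjac U V) \<le> k + l" using pdeg_pjac_le[of U V] by (simp add: kl)
  moreover have "3 * k \<le> card A * k" "3 * l \<le> card B * l"
    using A(3) B(3) by (intro mult_le_mono1; simp)+
  ultimately have deg: "card A + card B + 2 * k + 2 * l \<le> pdeg g"
    using sum unfolding kl mult_Suc_right by linarith
  show ?thesis
  proof (rule that[OF UV \<phi>f J])
    show "pdeg f \<le> pdeg g" using deg deg_f by simp
    show "pdeg U \<le> 1 \<and> pdeg V \<le> 1" if "pdeg f = pdeg g"
      using that deg deg_f kl by simp
  qed
qed

text \<open>With equal degrees both images are affine, so \<open>pjac U V\<close> is the constant
  determinant, and it is nonzero.\<close>

lemma poisson_morphism_affine:
  fixes g :: "'k::field_char_0 poly2"
  assumes \<phi>: "poisson_morphism (emb f) (emb g) \<phi>" and g: "g \<noteq> 0"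
    and f: "f = pconst c * (\<Prod>i\<in>A. pX + pconst (\<xi> i)) * (\<Prod>j\<in>B. pY + pconst (\<eta> j))"
    and c: "c \<noteq> 0" and A: "finite A" "inj_on \<xi> A" "3 \<le> card A"
    and B: "finite B" "inj_on \<eta> B" "3 \<le> card B" and eq: "pdeg f = pdeg g"
  obtains a b e a' b' e' where
    "\<phi> rX = rconst a * rX + rconst b * rY + rconst e"
    "\<phi> rY = rconst a' * rX + rconst b' * rY + rconst e'"
    "a * b' - b * a' \<noteq> 0" "\<phi> (emb f) = rconst (a * b' - b * a') * emb g"
proof -
  obtain U V where UV: "\<phi> rX = emb U" "\<phi> rY = emb V" "\<phi> (emb f) = emb (pjac U V * g)"
    "pjac U V \<noteq> 0" "pdeg U \<le> 1 \<and> pdeg V \<le> 1"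
    using poisson_morphism_degree[OF \<phi> g f c A B] eq by metis
  obtain a b e where U: "U = pconst a * pX + pconst b * pY + pconst e"
    using pdeg_le_1_imp_affine UV(5) by blast
  obtain a' b' e' where V: "V = pconst a' * pX + pconst b' * pY + pconst e'"
    using pdeg_le_1_imp_affine UV(5) by blast
  have J: "pjac U V = pconst (a * b' - b * a')" unfolding U V by (rule pjac_affine)
  show ?thesis
    by (rule that[of a b e a' b' e'])
      (use UV(1-4) in \<open>simp_all add: J emb_simps\<close>, simp_all add: U V emb_simps)
qed

section \<open>Restriction to polynomials\<close>

text \<open>The description is unique because \<open>emb\<close> is injective; it denotes the
  restriction of \<open>\<phi>\<close> only where \<open>\<phi>\<close> sends polynomials to
  polynomials.\<close>

definition restrict_poly :: "('k::field_char_0 rat2 \<Rightarrow> 'k rat2) \<Rightarrow> 'k poly2 \<Rightarrow> 'k poly2"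
  where "restrict_poly \<phi> p = (THE q. emb q = \<phi> (emb p))"

lemma emb_restrict_poly:
  assumes "\<phi> (emb p) \<in> range emb"
  shows "emb (restrict_poly \<phi> p) = \<phi> (emb p)"
proof -
  obtain q where q: "\<phi> (emb p) = emb q" using assms by blast
  show ?thesis
    unfolding restrict_poly_def by (rule theI[of _ q]) (simp_all add: q)
qed

lemma restrict_poly_comp:
  assumes "\<And>p. \<phi> (emb p) \<in> range emb" "\<And>p. \<psi> (emb p) \<in> range emb"
  shows "restrict_poly (\<psi> \<circ> \<phi>) = restrict_poly \<psi> \<circ> restrict_poly \<phi>"
proof
  fix p
  have "emb (restrict_poly \<psi> (restrict_poly \<phi> p)) = \<psi> (emb (restrict_poly \<phi> p))"
    by (rule emb_restrict_poly) (rule assms(2))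
  also have "\<dots> = (\<psi> \<circ> \<phi>) (emb p)"
    using emb_restrict_poly[of \<phi> p, OF assms(1)] by simp
  finally have "emb (restrict_poly \<psi> (restrict_poly \<phi> p)) = (\<psi> \<circ> \<phi>) (emb p)" .
  moreover from this have "emb (restrict_poly (\<psi> \<circ> \<phi>) p) = (\<psi> \<circ> \<phi>) (emb p)"
    by (metis emb_restrict_poly rangeI)
  ultimately show "restrict_poly (\<psi> \<circ> \<phi>) p = (restrict_poly \<psi> \<circ> restrict_poly \<phi>) p"
    by (metis comp_apply emb_eq_iff)
qed

lemma restrict_poly_alg_hom:
  assumes \<phi>: "alg_hom rconst rconst \<phi>" and range: "\<And>p. \<phi> (emb p) \<in> range emb"
  shows "alg_hom pconst pconst (restrict_poly \<phi>)"
proof -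
  note E = emb_restrict_poly[of \<phi>, OF range]
  have "emb (restrict_poly \<phi> (a + b)) = emb (restrict_poly \<phi> a + restrict_poly \<phi> b)"
    "emb (restrict_poly \<phi> (a * b)) = emb (restrict_poly \<phi> a * restrict_poly \<phi> b)"
    "emb (restrict_poly \<phi> (pconst d)) = emb (pconst d)"
    "emb (restrict_poly \<phi> 1) = emb 1" for a b d
    by (simp_all only: E emb_simps alg_homD[OF \<phi>])
  then show ?thesis unfolding alg_hom_def by simp
qed

text \<open>Every rational function is a quotient of polynomials, and field homomorphisms respect
  quotients.\<close>

lemma restrict_poly_inj:
  fixes \<phi> \<psi> :: "'k::field_char_0 rat2 \<Rightarrow> 'k rat2"
  assumes \<phi>: "alg_hom rconst rconst \<phi>" "\<And>p. \<phi> (emb p) \<in> range emb"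
    and \<psi>: "alg_hom rconst rconst \<psi>" "\<And>p. \<psi> (emb p) \<in> range emb"
    and eq: "restrict_poly \<phi> = restrict_poly \<psi>"
  shows "\<phi> = \<psi>"
proof
  fix u :: "'k rat2"
  obtain a b where u: "u = emb a / emb b" by (rule rat2_quotient)
  have "\<phi> (emb p) = \<psi> (emb p)" for p
    using emb_restrict_poly[of \<phi> p, OF \<phi>(2)] emb_restrict_poly[of \<psi> p, OF \<psi>(2)] eq by simp
  then show "\<phi> u = \<psi> u" by (simp add: u alg_hom_divide[OF \<phi>(1)] alg_hom_divide[OF \<psi>(1)])
qed

section \<open>Embedding the Poisson automorphism group\<close>

lemma Aut_Poi_simps:
  "carrier (Aut_Poi f) = {\<phi>. poisson_aut f \<phi>}"
  "\<phi> \<in> carrier (Aut_Poi f) \<Longrightarrow> \<psi> \<in> carrier (Aut_Poi f) \<Longrightarrow> \<phi> \<otimes>\<^bsub>Aut_Poi f\<^esub> \<psi> = \<phi> \<circ> \<psi>"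
  by (simp_all add: Aut_Poi_def BijGroup_def Bij_def poisson_aut_def compose_def comp_def restrict_def)

lemma Aut_semi_invariant_simps:
  "carrier (Aut_semi_invariant f)
    = {\<psi>. alg_iso pconst pconst \<psi> \<and> (\<exists>c. c \<noteq> 0 \<and> \<psi> f = pconst c * f)}"
  "\<phi> \<in> carrier (Aut_semi_invariant f) \<Longrightarrow> \<psi> \<in> carrier (Aut_semi_invariant f) \<Longrightarrow>
    \<phi> \<otimes>\<^bsub>Aut_semi_invariant f\<^esub> \<psi> = \<phi> \<circ> \<psi>"
  by (auto simp: Aut_semi_invariant_def BijGroup_def Bij_def alg_iso_def compose_def comp_def
      restrict_def)

text \<open>\<open>H\<close> is the image of the restriction map, an injective group homomorphism;
  \<open>semi\<close> places the restrictions in the target group.\<close>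

lemma Aut_Poi_iso_subgroup:
  fixes f :: "'k::field_char_0 poly2"
  assumes range: "\<And>\<phi> p. poisson_aut (emb f) \<phi> \<Longrightarrow> \<phi> (emb p) \<in> range emb"
    and semi: "\<And>\<phi>. poisson_aut (emb f) \<phi> \<Longrightarrow> \<exists>d. d \<noteq> 0 \<and> \<phi> (emb f) = rconst d * emb f"
  shows "\<exists>H. subgroup H (Aut_semi_invariant f) \<and>
    Aut_Poi (emb f) \<cong> (Aut_semi_invariant f)\<lparr>carrier := H\<rparr>"
proof -
  let ?G = "Aut_Poi (emb f)" and ?S = "Aut_semi_invariant f"
  have aut: "alg_hom rconst rconst \<phi>" "bij \<phi>" if "poisson_aut (emb f) \<phi>" for \<phi>
    using that by (simp_all add: poisson_aut_def poisson_morphism_def)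
  have inv_aut: "poisson_aut (emb f) (inv_into UNIV \<phi>)" if "poisson_aut (emb f) \<phi>" for \<phi>
  proof -
    have "inv\<^bsub>BijGroup UNIV\<^esub> \<phi> \<in> carrier ?G"
      using subgroup.m_inv_closed[OF subgroup_Aut_Poi] that by (simp add: Aut_Poi_simps)
    moreover have "\<phi> \<in> Bij UNIV" using aut(2)[OF that] by (simp add: Bij_def)
    ultimately show ?thesis
      by (simp add: inv_BijGroup restrict_def Aut_Poi_simps)
  qed
  have restrict_id: "restrict_poly id = id"
    by (rule ext) (metis emb_eq_iff emb_restrict_poly id_apply rangeI)
  have mem: "restrict_poly \<phi> \<in> carrier ?S" if \<phi>: "poisson_aut (emb f) \<phi>" for \<phi>
  proof -
    obtain d where d: "d \<noteq> 0" "\<phi> (emb f) = rconst d * emb f" using semi[OF \<phi>] by blast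
    have "emb (restrict_poly \<phi> f) = emb (pconst d * f)"
      by (simp only: emb_restrict_poly[of \<phi>, OF range[OF \<phi>]] d emb_simps)
    then have "restrict_poly \<phi> f = pconst d * f" by simp
    \<comment> \<open>The inverse is a Poisson automorphism too, so \<open>range\<close> applies to
      it and its restriction inverts that of \<open>\<phi>\<close>.\<close>
    moreover have "restrict_poly \<phi> \<circ> restrict_poly (inv_into UNIV \<phi>) = id"
      "restrict_poly (inv_into UNIV \<phi>) \<circ> restrict_poly \<phi> = id"
      using bij_is_surj[OF aut(2)[OF \<phi>]] bij_is_inj[OF aut(2)[OF \<phi>]] restrict_id
      by (simp_all add: range \<phi> inv_aut surj_iff inj_iff flip: restrict_poly_comp)
    then have "bij (restrict_poly \<phi>)" using o_bij by blast
    ultimately show ?thesis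
      using restrict_poly_alg_hom[OF aut(1)[OF \<phi>] range[OF \<phi>]] d(1)
      by (auto simp: Aut_semi_invariant_simps alg_iso_def)
  qed
  have hom: "restrict_poly \<in> hom ?G ?S"
  proof (rule homI)
    fix \<phi> \<psi> assume a: "\<phi> \<in> carrier ?G" "\<psi> \<in> carrier ?G"
    then have "poisson_aut (emb f) \<phi>" "poisson_aut (emb f) \<psi>" by (simp_all add: Aut_Poi_simps)
    then show "restrict_poly (\<phi> \<otimes>\<^bsub>?G\<^esub> \<psi>) = restrict_poly \<phi> \<otimes>\<^bsub>?S\<^esub> restrict_poly \<psi>"
      by (simp add: Aut_Poi_simps(2)[OF a] Aut_semi_invariant_simps(2)[OF mem mem]
          restrict_poly_comp range)
  qed (simp add: Aut_Poi_simps mem)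
  let ?H = "restrict_poly ` carrier ?G"
  have "inj_on restrict_poly (carrier ?G)"
    by (rule inj_onI) (auto simp: Aut_Poi_simps intro!: restrict_poly_inj aut range)
  then have "restrict_poly \<in> iso ?G (?S\<lparr>carrier := ?H\<rparr>)"
    using hom by (simp add: iso_def hom_def bij_betw_def)
  moreover have "subgroup ?H ?S"
    using hom by (intro group_hom.img_is_subgroup group_hom.intro group_hom_axioms.intro
        group_Aut_Poi group_Aut_semi_invariant)
  ultimately show ?thesis using is_isoI by metis
qed

text \<open>Parsing the theorem takes time exponential in the number of \<open>$\<close> if the symbol has two readings.\<close>

no_notation Matrix.vec_index (infixl "$" 100)

theorem proposition7p3:
  fixes f g :: "'k::field_char_0 poly2"
    and \<phi> :: "'k rat2 \<Rightarrow> 'k rat2"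
    and c :: 'k and \<xi> \<eta> :: "nat \<Rightarrow> 'k" and m n :: nat
  assumes "f \<noteq> 0" and "g \<noteq> 0"
    and "poisson_morphism (emb f) (emb g) \<phi>"
    and "f = pconst c * (\<Prod>i=1..m. pX + pconst (\<xi> i)) * (\<Prod>j=1..n. pY + pconst (\<eta> j))"
    and "c \<noteq> 0" and "inj_on \<xi> {1..m}" and "inj_on \<eta> {1..n}"
    and "m \<ge> 3" and "n \<ge> 3"
  shows "((\<exists>h. \<phi> (emb f) = emb (h * g)) \<and> pdeg f \<le> pdeg g) \<and>
    (pdeg f = pdeg g \<longrightarrow>
      (\<forall>u. u \<noteq> 0 \<longrightarrow> rdeg (\<phi> u) = rdeg u) \<and>
      alg_iso rconst rconst \<phi> \<and>
      (\<exists>(C :: 'k^2^2) c1 c2. invertible C \<and>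
        \<phi> rX = rconst (C$1$1) * rX + rconst (C$1$2) * rY + rconst c1 \<and>
        \<phi> rY = rconst (C$2$1) * rX + rconst (C$2$2) * rY + rconst c2 \<and>
        \<phi> (emb f) = rconst (C$1$1 * C$2$2 - C$1$2 * C$2$1) * emb g)) \<and>
    dixmier (emb f) \<and>
    (\<exists>H. subgroup H (Aut_semi_invariant f) \<and>
      Aut_Poi (emb f) \<cong> (Aut_semi_invariant f)\<lparr>carrier := H\<rparr>)"
proof (intro conjI impI)
  have card: "3 \<le> card {1..m}" "3 \<le> card {1..n}" using assms(8,9) by simp_all
  note roots = assms(4,5) finite_atLeastAtMost assms(6) card(1) finite_atLeastAtMost assms(7) card(2)
  \<comment> \<open>Kept general in \<open>\<psi>\<close> and \<open>h\<close>: it is used for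
    \<open>\<phi>\<close> with \<open>h = g\<close>, and for endomorphisms with
    \<open>h = f\<close>.\<close>
  have affine: "\<exists>a b e a' b' e'. \<psi> rX = rconst a * rX + rconst b * rY + rconst e \<and>
      \<psi> rY = rconst a' * rX + rconst b' * rY + rconst e' \<and>
      a * b' - b * a' \<noteq> 0 \<and> \<psi> (emb f) = rconst (a * b' - b * a') * emb h"
    if "poisson_morphism (emb f) (emb h) \<psi>" "h \<noteq> 0" "pdeg f = pdeg h" for \<psi> h
    using poisson_morphism_affine[OF that(1,2) roots that(3)] by metis
  show "\<exists>h. \<phi> (emb f) = emb (h * g)" "pdeg f \<le> pdeg g"
    using poisson_morphism_degree[OF assms(3,2) roots] by metis+
  have hom: "alg_hom rconst rconst \<phi>" using assms(3) by (simp add: poisson_morphism_def)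
  {
    assume "pdeg f = pdeg g"
    then obtain a b e a' b' e' where *:
      "\<phi> rX = rconst a * rX + rconst b * rY + rconst e"
      "\<phi> rY = rconst a' * rX + rconst b' * rY + rconst e'"
      "a * b' - b * a' \<noteq> 0" "\<phi> (emb f) = rconst (a * b' - b * a') * emb g"
      using affine[OF assms(3,2)] by blast
    show "\<forall>u. u \<noteq> 0 \<longrightarrow> rdeg (\<phi> u) = rdeg u"
      using affine_alg_hom_rdeg[OF hom *(1-3)] by blast
    show "alg_iso rconst rconst \<phi>"
      using hom affine_alg_hom_inverse(1)[OF hom *(1-3)] by (simp add: alg_iso_def)
    define C :: "'k^2^2" where "C = vector [vector [a, b], vector [a', b']]"
    have C: "C$1$1 = a" "C$1$2 = b" "C$2$1 = a'" "C$2$2 = b'"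
      by (simp_all add: C_def vector_2)
    have "invertible C" using *(3) by (simp add: invertible_det_nz det_2 C)
    then show "\<exists>(C :: 'k^2^2) c1 c2. invertible C \<and>
        \<phi> rX = rconst (C$1$1) * rX + rconst (C$1$2) * rY + rconst c1 \<and>
        \<phi> rY = rconst (C$2$1) * rX + rconst (C$2$2) * rY + rconst c2 \<and>
        \<phi> (emb f) = rconst (C$1$1 * C$2$2 - C$1$2 * C$2$1) * emb g"
      using *(1,2,4) C by metis
  }
  show "dixmier (emb f)"
    unfolding dixmier_def
  proof (intro allI impI)
    fix \<psi> assume \<psi>: "poisson_morphism (emb f) (emb f) \<psi>"
    then have "alg_hom rconst rconst \<psi>" by (simp add: poisson_morphism_def)
    \<comment> \<open>For an endomorphism the degree equality is reflexivity, so
      \<open>\<psi>\<close> is affine with nonzero determinant.\<close>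
    then have "bij \<psi>" using affine[OF \<psi> assms(1) refl] affine_alg_hom_inverse(1) by blast
    then show "poisson_aut (emb f) \<psi>" using \<psi> by (simp add: poisson_aut_def)
  qed
  show "\<exists>H. subgroup H (Aut_semi_invariant f) \<and>
      Aut_Poi (emb f) \<cong> (Aut_semi_invariant f)\<lparr>carrier := H\<rparr>"
  proof (rule Aut_Poi_iso_subgroup)
    fix \<psi> assume "poisson_aut (emb f) \<psi>"
    then have \<psi>: "poisson_morphism (emb f) (emb f) \<psi>" "alg_hom rconst rconst \<psi>"
      by (simp_all add: poisson_aut_def poisson_morphism_def)
    obtain a b e a' b' e' where *:
      "\<psi> rX = rconst a * rX + rconst b * rY + rconst e"
      "\<psi> rY = rconst a' * rX + rconst b' * rY + rconst e'"
      "a * b' - b * a' \<noteq> 0" "\<psi> (emb f) = rconst (a * b' - b * a') * emb f"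
      using affine[OF \<psi>(1) assms(1) refl] by blast
    \<comment> \<open>The semi-invariance factor \<open>d\<close> is the determinant.\<close>
    show "\<exists>d. d \<noteq> 0 \<and> \<psi> (emb f) = rconst d * emb f" using * by blast
    show "\<psi> (emb p) \<in> range emb" for p
      using affine_alg_hom_pdeg[OF \<psi>(2) *(1-3), of p] by (metis rangeI)
  qed
qed

end
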